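(* Fix an integer $q\geq 2$ and let $\mathbb{X}=\{X_i,i\in\mathbb{N}\}$ be a sequence of centered independent real random variables such that $\mathbb{E}[X_i^2]=1$ for each $i\in\mathbb{N}$ and $\sup\{\mathbb{E}[|X_j|^{2+\delta}]:j\in\mathbb{N}\}<\infty$ for some $\delta>0$. Let $(F_n,n\geq1)$ be a sequence of random variables such that: (i) for each $n\geq1$, $F_n=\mathbb{E}[F_n]+\sum_{p=1}^q Q_p(f_{p,n};\mathbb{X})$ with $f_{p,n}\in\ell^2_0(\mathbb{N})^{\odot p}$ for each $p\in\{1,\dots,q\}$; (ii) $F_n$ converges almost surely to a random variable $F$ of the form $F=\mathbb{E}[F]+\sum_{p=1}^q Q_p(f_p;\mathbb{X})$ with $f_p\in\ell^2_0(\mathbb{N})^{\odot p}$ for each $p\in\{1,\dots,q\}$. Then, as $n\to+\infty$, $\mathbb{E}[F_n]\to\mathbb{E}[F]$, and for each $p\in\{1,\dots,q\}$, $Q_p(f_{p,n};\mathbb{X})$ converges almost surely to $Q_p(f_p;\mathbb{X})$.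
   Context: $\mathbb{N}=\{1,2,\dots\}$. For $p\geq1$, $\ell^2_0(\mathbb{N})^{\odot p}$ is the set of $f\in\ell^2(\mathbb{N})^{\otimes p}$ (i.e. square-summable functions on $\mathbb{N}^p$) that are symmetric in their arguments and vanish on diagonals, i.e. $f(i_1,\dots,i_p)=0$ whenever $i_j=i_k$ for some $j\neq k$. For such $f$, the homogeneous sum of order $p$ is $Q_p(f;\mathbb{X})=\sum_{i_1,\dots,i_p\in\mathbb{N}} f(i_1,\dots,i_p)X_{i_1}\cdots X_{i_p}$, the series converging in $L^2(\mathbb{P})$ since the $X_i$ are independent, centered, with unit variance. *)

theory Defs
  imports "HOL-Probability.Probability"
begin

definition Npow :: "nat \<Rightarrow> nat list set" where
  "Npow p = {l. length l = p \<and> set l \<subseteq> {1..}}"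

definition ell2_0_sym :: "nat \<Rightarrow> (nat list \<Rightarrow> real) \<Rightarrow> bool" where
  "ell2_0_sym p f \<longleftrightarrow>
     (\<lambda>l. (f l)\<^sup>2) summable_on Npow p \<and>
     (\<forall>l\<in>Npow p. \<forall>l'\<in>Npow p. mset l = mset l' \<longrightarrow> f l = f l') \<and>
     (\<forall>l\<in>Npow p. \<not> distinct l \<longrightarrow> f l = 0)"

definition Qp_partial :: "nat \<Rightarrow> (nat list \<Rightarrow> real) \<Rightarrow> (nat \<Rightarrow> 'a \<Rightarrow> real) \<Rightarrow> nat \<Rightarrow> 'a \<Rightarrow> real" where
  "Qp_partial p f X N \<omega> =
     (\<Sum>l\<in>{l. length l = p \<and> set l \<subseteq> {1..N}}. f l * prod_list (map (\<lambda>i. X i \<omega>) l))"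

definition is_Qp :: "'a measure \<Rightarrow> (nat \<Rightarrow> 'a \<Rightarrow> real) \<Rightarrow> nat \<Rightarrow> (nat list \<Rightarrow> real) \<Rightarrow> ('a \<Rightarrow> real) \<Rightarrow> bool" where
  "is_Qp M X p f G \<longleftrightarrow> G \<in> borel_measurable M \<and>
     (\<lambda>N. \<integral>\<^sup>+\<omega>. ennreal ((G \<omega> - Qp_partial p f X N \<omega>)\<^sup>2) \<partial>M) \<longlonglongrightarrow> 0"

text \<open>The homogeneous sum Q_p(f;X): the L^2 limit (a representative; unique up to a.e. equality).\<close>
definition Qp :: "'a measure \<Rightarrow> (nat \<Rightarrow> 'a \<Rightarrow> real) \<Rightarrow> nat \<Rightarrow> (nat list \<Rightarrow> real) \<Rightarrow> 'a \<Rightarrow> real" where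
  "Qp M X p f = (SOME G. is_Qp M X p f G)"

end

theory Submission
  imports Defs
begin

text \<open>
  After subtracting \<open>F\<close> and replacing each homogeneous sum by a finite partial sum with
  \<open>L\<^sup>2\<close>-error at most \<open>2\<^sup>-\<^sup>n\<close> (Borel--Cantelli), one has polynomials \<open>Z\<^sub>n\<close> of degree at most \<open>q\<close>,
  affine in each variable, with \<open>Z\<^sub>n(X) \<rightarrow> 0\<close> almost surely.  For \<open>0 < s < 1\<close> let \<open>X\<^sub>i'\<close> be equal to
  \<open>X\<^sub>i\<close> with probability \<open>s\<close> and to an independent copy of \<open>X\<^sub>i\<close> otherwise, independently over \<open>i\<close>.
  The sequence \<open>X'\<close> has the law of \<open>X\<close>, so by Fubini, for almost every fixed \<open>X\<close>, \<open>Z\<^sub>n(X') \<rightarrow> 0\<close>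
  almost surely in the extra randomness.  Given \<open>X\<close>, the variables \<open>X\<^sub>i' - s X\<^sub>i\<close> are independent and
  centered, and their moments of order \<open>2 + \<delta>\<close> are controlled by their variances uniformly in \<open>i\<close> and
  \<open>X\<close>; hypercontractivity and a Paley--Zygmund argument upgrade the convergence to \<open>L\<^sup>2\<close>, hence the
  conditional mean of \<open>Z\<^sub>n(X')\<close>, which is \<open>Z\<^sub>n(s X)\<close>, tends to 0.  As a polynomial in \<open>s\<close> it has the
  homogeneous parts of \<open>Z\<^sub>n(X)\<close> as coefficients, so each of them tends to 0.
\<close>

section \<open>Moment inequalities\<close>

text \<open>Young's inequality for \<open>x\<close> and \<open>1\<close> with weights
  \<open>a\<close> and \<open>1 - a\<close>: the concave power lies below its tangent at 1.\<close>

lemma powr_le_affine: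
  fixes x a :: real
  assumes "0 \<le> x" "0 \<le> a" "a \<le> 1"
  shows "x powr a \<le> 1 + a * (x - 1)"
proof (cases "x = 0")
  case False
  then have "x powr a * 1 powr (1 - a) \<le> a * x + (1 - a) * 1"
    using assms by (intro Youngs_inequality_0) auto
  then show ?thesis by (simp add: algebra_simps)
qed (use assms in auto)

lemma powr_one_plus:
  fixes y r :: real
  assumes "0 \<le> y" shows "y powr r = y * y powr (r - 1)"
  using powr_mult_base[of y "r - 1"] assms by simp

text \<open>The linear term is the exact first-order term, so it integrates to zero for a centered
  \<open>x\<close>, and the remainder involves only the two moments at hand. For
  \<open>\<bar>x\<bar> \<le> 1\<close>, \<open>powr_le_affine\<close> with exponent
  \<open>r - 1\<close> expands to second order in \<open>u = 2 * x + x^2\<close>; for larger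
  \<open>x\<close>, \<open>\<bar>1 + x\<bar> \<le> 2 * \<bar>x\<bar>\<close> and
  \<open>4 powr r \<le> 16\<close>.\<close>

lemma one_plus_sq_powr_le:
  fixes x r :: real
  assumes "1 \<le> r" "r \<le> 2"
  shows "((1 + x)\<^sup>2) powr r \<le> 1 + 2 * r * x + 16 * (x\<^sup>2 + (x\<^sup>2) powr r)"
proof (cases "\<bar>x\<bar> \<le> 1")
  case True
  define u where "u = 2 * x + x\<^sup>2"
  have u1: "1 + u = (1 + x)\<^sup>2" by (simp add: u_def power2_eq_square algebra_simps)
  then have "0 \<le> 1 + u" by simp
  have "(1 + u) powr r = (1 + u) * (1 + u) powr (r - 1)"
    using \<open>0 \<le> 1 + u\<close> by (rule powr_one_plus)
  also have "\<dots> \<le> (1 + u) * (1 + (r - 1) * u)"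
    using powr_le_affine[of "1 + u" "r - 1"] \<open>0 \<le> 1 + u\<close> assms by (intro mult_left_mono) auto
  also have "\<dots> = 1 + r * u + (r - 1) * u\<^sup>2" by (simp add: algebra_simps power2_eq_square)
  finally have *: "((1 + x)\<^sup>2) powr r \<le> 1 + r * u + (r - 1) * u\<^sup>2" unfolding u1 .
  have "u = x * (2 + x)" by (simp add: u_def power2_eq_square algebra_simps)
  then have "u\<^sup>2 = x\<^sup>2 * (2 + x)\<^sup>2" by (simp add: power_mult_distrib)
  also have "\<dots> \<le> x\<^sup>2 * 3\<^sup>2" using True by (intro mult_left_mono power_mono) auto
  finally have "u\<^sup>2 \<le> 9 * x\<^sup>2" by simp
  then have "(r - 1) * u\<^sup>2 \<le> 1 * (9 * x\<^sup>2)" using assms by (intro mult_mono) auto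
  moreover have "r * u \<le> 2 * r * x + 2 * x\<^sup>2"
    using assms by (simp add: u_def algebra_simps mult_right_mono)
  ultimately show ?thesis using * powr_ge_zero[of "x\<^sup>2" r] zero_le_power2[of x] by (simp only: distrib_left)
next
  case False
  have "(1 + x)\<^sup>2 \<le> 4 * x\<^sup>2"
    using abs_le_square_iff[of "1 + x" "2 * x"] False by (auto simp: power_mult_distrib)
  then have "((1 + x)\<^sup>2) powr r \<le> (4 * x\<^sup>2) powr r" using assms by (intro powr_mono2) auto
  also have "\<dots> = 4 powr r * (x\<^sup>2) powr r" by (rule powr_mult)
  also have "\<dots> \<le> 16 * (x\<^sup>2) powr r"
    using powr_mono[of r 2 "4::real"] assms by (intro mult_right_mono) auto
  finally have *: "((1 + x)\<^sup>2) powr r \<le> 16 * (x\<^sup>2) powr r" .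
  have "\<bar>x\<bar> * 1 \<le> \<bar>x\<bar> * \<bar>x\<bar>" using False by (intro mult_left_mono) auto
  then have "\<bar>x\<bar> \<le> x\<^sup>2" by (simp add: power2_eq_square)
  moreover have "\<bar>r * x\<bar> \<le> 2 * \<bar>x\<bar>" using assms by (simp add: abs_mult mult_right_mono)
  ultimately have "0 \<le> 2 * (r * x) + 16 * x\<^sup>2" by linarith
  then show ?thesis using * by (simp only: distrib_left mult.assoc)
qed

text \<open>Serves to absorb the remainder of \<open>one_plus_sq_powr_le\<close> into a single
  power. Writing \<open>(1 + y) powr r\<close> as \<open>(1 + y) * (1 + y) powr (r - 1)\<close>, the
  first summand is at least 1 and the second dominates both \<open>y\<close> and
  \<open>y powr r\<close>.\<close>

lemma one_plus_powr_ge: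
  fixes y r :: real
  assumes "0 \<le> y" "1 \<le> r"
  shows "1 + (y + y powr r) / 2 \<le> (1 + y) powr r"
proof -
  have arith: "1 + (y + z) / 2 \<le> p + w" if "z \<le> w" "y \<le> w" "1 \<le> p" for p w z :: real
    using that by argo
  have "y * y powr (r - 1) \<le> y * (1 + y) powr (r - 1)"
    using assms by (intro mult_left_mono powr_mono2) auto
  moreover have "1 \<le> (1 + y) powr (r - 1)" using assms by (simp add: ge_one_powr_ge_zero)
  moreover have "y \<le> y * (1 + y) powr (r - 1)"
    using assms \<open>1 \<le> (1 + y) powr (r - 1)\<close> by (simp add: mult_le_cancel_left1)
  ultimately show ?thesis
    using powr_one_plus[of "1 + y" r] powr_one_plus[of y r] assms
    by (auto simp: distrib_right intro: arith)
qed

text \<open>The coefficient of \<open>a\<^sup>2\<close> has to be exactly 1, or constants would accumulate in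
  the induction over the variables in \<open>mpol_moments\<close>; the value of the other one is immaterial.\<close>
lemma affine_moment_le:
  fixes v K a b r :: real
  assumes "prob_space P" "sets P = sets borel" "1 \<le> r" "r \<le> 2" "1 \<le> K" "0 \<le> v"
    and int: "integrable P (\<lambda>y. y)" "integrable P (\<lambda>y. y\<^sup>2)"
    and mean: "(\<integral>y. y \<partial>P) = m" and var: "(\<integral>y. (y - m)\<^sup>2 \<partial>P) = v"
    and mom: "(\<integral>\<^sup>+y. ((y - m)\<^sup>2) powr r \<partial>P) \<le> (K * v) powr r"
  shows "(\<integral>\<^sup>+y. ((a + b * (y - m))\<^sup>2) powr r \<partial>P) \<le> (a\<^sup>2 + 32 * K * (v * b\<^sup>2)) powr r"
proof -
  interpret prob_space P by fact
  have [measurable_cong]: "sets P = sets borel" by fact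
  have meas[measurable]: "(\<lambda>y. c + d * (y - m)) \<in> borel_measurable P" for c d by measurable
  have scale: "(\<integral>\<^sup>+y. ((d * (y - m))\<^sup>2) powr r \<partial>P) \<le> (K * (v * d\<^sup>2)) powr r" for d
  proof -
    have "(\<integral>\<^sup>+y. ((d * (y - m))\<^sup>2) powr r \<partial>P) = (\<integral>\<^sup>+y. (d\<^sup>2) powr r * ennreal (((y - m)\<^sup>2) powr r) \<partial>P)"
      by (simp add: power_mult_distrib powr_mult ennreal_mult')
    also have "\<dots> = (d\<^sup>2) powr r * (\<integral>\<^sup>+y. ((y - m)\<^sup>2) powr r \<partial>P)" by (intro nn_integral_cmult) measurable
    also have "\<dots> \<le> (d\<^sup>2) powr r * ennreal ((K * v) powr r)" by (intro mult_left_mono mom) auto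
    also have "\<dots> = (K * (v * d\<^sup>2)) powr r"
      by (simp add: powr_mult ennreal_mult' mult_ac flip: ennreal_mult')
    finally show ?thesis .
  qed
  show ?thesis
  proof (cases "a = 0")
    case True
    then have "(\<integral>\<^sup>+y. ((a + b * (y - m))\<^sup>2) powr r \<partial>P) \<le> (K * (v * b\<^sup>2)) powr r" using scale[of b] by simp
    also have "\<dots> \<le> (a\<^sup>2 + 32 * K * (v * b\<^sup>2)) powr r"
      using assms True by (intro ennreal_leI powr_mono2 mult_nonneg_nonneg) auto
    finally show ?thesis .
  next
    case False
    \<comment> \<open>Dividing by \<open>a\<close> makes the constant term 1, as
      \<open>one_plus_sq_powr_le\<close> requires; \<open>w\<close> is the variance of
      \<open>d * (y - m)\<close>.\<close>
    define d where "d = b / a"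
    define w where "w = v * d\<^sup>2"
    have "0 \<le> w" using assms by (simp add: w_def)
    have fin: "(\<integral>\<^sup>+y. ((d * (y - m))\<^sup>2) powr r \<partial>P) < \<infinity>" using scale[of d] by (simp add: order_le_less_trans)
    have i3: "integrable P (\<lambda>y. ((d * (y - m))\<^sup>2) powr r)"
      using fin by (intro integrableI_nonneg) auto
    have i2': "integrable P (\<lambda>y. (y - m)\<^sup>2)" using int by (simp add: power2_diff)
    have i2: "integrable P (\<lambda>y. (d * (y - m))\<^sup>2)" using i2' by (simp add: power_mult_distrib)
    have i1: "integrable P (\<lambda>y. d * (y - m))" using int by simp
    have e3: "(\<integral>y. ((d * (y - m))\<^sup>2) powr r \<partial>P) \<le> (K * w) powr r"
      using scale[of d] nn_integral_eq_integral[OF i3] by (simp add: w_def)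
    have e2: "(\<integral>y. (d * (y - m))\<^sup>2 \<partial>P) = w" using var by (simp add: power_mult_distrib w_def)
    have e1: "(\<integral>y. d * (y - m) \<partial>P) = 0" using int mean prob_space by simp
    let ?g = "\<lambda>y. 1 + 2 * r * (d * (y - m)) + 16 * ((d * (y - m))\<^sup>2 + ((d * (y - m))\<^sup>2) powr r)"
    have pt: "((1 + d * (y - m))\<^sup>2) powr r \<le> ?g y" for y
      using assms by (intro one_plus_sq_powr_le) auto
    have ig: "integrable P ?g" using i1 i2 i3 by simp
    have "(\<integral>\<^sup>+y. ((1 + d * (y - m))\<^sup>2) powr r \<partial>P) \<le> (\<integral>\<^sup>+y. ?g y \<partial>P)"
      by (intro nn_integral_mono ennreal_leI pt)
    also have "\<dots> = (\<integral>y. ?g y \<partial>P)"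
      using pt by (intro nn_integral_eq_integral ig AE_I2) (meson order_trans powr_ge_zero)
    also have "(\<integral>y. ?g y \<partial>P) = 1 + 2 * r * 0 + 16 * (w + (\<integral>y. ((d * (y - m))\<^sup>2) powr r \<partial>P))"
      unfolding e1[symmetric] e2[symmetric] using i1 i2 i3 prob_space
      by (simp del: Bochner_Integration.integral_mult_right_zero Bochner_Integration.integral_mult_right)
        simp
    also have "\<dots> \<le> 1 + 16 * (w + (K * w) powr r)" using e3 by simp
    \<comment> \<open>The factor 32 is twice 16, to match the halving in
      \<open>one_plus_powr_ge\<close>: \<open>w \<le> K * w\<close> handles the first term and
      \<open>32 \<le> 32 powr r\<close> the second.\<close>
    also have "\<dots> \<le> 1 + (32 * K * w + (32 * K * w) powr r) / 2"
    proof -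
      have "w \<le> K * w" using \<open>0 \<le> w\<close> \<open>1 \<le> K\<close> by (simp add: mult_le_cancel_right1)
      moreover have "32 * (K * w) powr r \<le> (32 * K * w) powr r"
        using powr_mono[of 1 r "32::real"] assms
        by (simp add: powr_mult mult.assoc mult_right_mono)
      ultimately show ?thesis by simp
    qed
    also have "\<dots> \<le> (1 + 32 * K * w) powr r"
      using assms \<open>0 \<le> w\<close> by (intro one_plus_powr_ge) auto
    finally have main: "(\<integral>\<^sup>+y. ((1 + d * (y - m))\<^sup>2) powr r \<partial>P) \<le> (1 + 32 * K * w) powr r"
      by (simp add: ennreal_leI)
    have "(\<integral>\<^sup>+y. ((a + b * (y - m))\<^sup>2) powr r \<partial>P)
        = (\<integral>\<^sup>+y. (a\<^sup>2) powr r * ennreal (((1 + d * (y - m))\<^sup>2) powr r) \<partial>P)"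
    proof (intro nn_integral_cong)
      fix y
      have "a + b * (y - m) = a * (1 + d * (y - m))" using False by (simp add: d_def field_simps)
      then show "ennreal (((a + b * (y - m))\<^sup>2) powr r) = (a\<^sup>2) powr r * ennreal (((1 + d * (y - m))\<^sup>2) powr r)"
        by (simp only: power_mult_distrib powr_mult ennreal_mult' powr_ge_zero)
    qed
    also have "\<dots> = (a\<^sup>2) powr r * (\<integral>\<^sup>+y. ((1 + d * (y - m))\<^sup>2) powr r \<partial>P)" by (intro nn_integral_cmult) measurable
    also have "\<dots> \<le> (a\<^sup>2) powr r * ennreal ((1 + 32 * K * w) powr r)" by (intro mult_left_mono main) auto
    also have "\<dots> = (a\<^sup>2 * (1 + 32 * K * w)) powr r" by (simp add: powr_mult ennreal_mult')
    also have "a\<^sup>2 * (1 + 32 * K * w) = a\<^sup>2 + 32 * K * (v * b\<^sup>2)"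
      using False by (simp add: w_def d_def field_simps)
    finally show ?thesis .
  qed
qed

text \<open>Convexity of the power on the closed half-line. When one argument is zero it amounts to
  \<open>s powr r \<le> s\<close> for \<open>0 < s < 1\<close>.\<close>

lemma powr_convex_le:
  fixes t u w r :: real
  assumes "1 \<le> r" "0 \<le> u" "0 \<le> w" "0 < t" "t < 1"
  shows "((1 - t) * u + t * w) powr r \<le> (1 - t) * u powr r + t * w powr r"
proof -
  have zero: "(s * z) powr r \<le> s * z powr r" if "0 < s" "s < 1" "0 \<le> z" for s z :: real
    using powr_mono'[of 1 r s] that assms by (simp add: powr_mult mult_right_mono)
  show ?thesis
  proof (cases "u = 0 \<or> w = 0")
    case True
    then show ?thesis using zero[of t w] zero[of "1 - t" u] assms by auto
  next
    case False
    then show ?thesis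
      using convex_onD[OF powr_convex[OF \<open>1 \<le> r\<close>], of t u w] assms by simp
  qed
qed

text \<open>Minkowski's inequality, stated through bounds \<open>a\<close> and \<open>b\<close> on
  the norms. It is convexity applied to \<open>u / a\<close> and \<open>v / b\<close> with weights
  \<open>a / (a + b)\<close> and \<open>b / (a + b)\<close>; a zero bound forces the function to
  vanish almost everywhere.\<close>

lemma Minkowski_powr:
  fixes u v :: "'a \<Rightarrow> real"
  assumes [measurable]: "u \<in> borel_measurable M" "v \<in> borel_measurable M"
    and "1 \<le> r" and nn: "\<And>x. 0 \<le> u x" "\<And>x. 0 \<le> v x" "0 \<le> a" "0 \<le> b"
    and u: "(\<integral>\<^sup>+x. u x powr r \<partial>M) \<le> a powr r" and v: "(\<integral>\<^sup>+x. v x powr r \<partial>M) \<le> b powr r"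
  shows "(\<integral>\<^sup>+x. (u x + v x) powr r \<partial>M) \<le> (a + b) powr r"
proof -
  have null: "AE x in M. w x = 0"
    if "(\<integral>\<^sup>+x. w x powr r \<partial>M) \<le> 0" "w \<in> borel_measurable M" for w :: "'a \<Rightarrow> real"
    using that by (simp add: nn_integral_0_iff_AE powr_nonneg_iff)
  consider "a = 0" | "b = 0" | "0 < a" "0 < b" using nn by linarith
  then show ?thesis
  proof cases
    case 1
    then have "AE x in M. u x = 0" using u by (intro null) auto
    then have "(\<integral>\<^sup>+x. (u x + v x) powr r \<partial>M) = (\<integral>\<^sup>+x. v x powr r \<partial>M)"
      by (intro nn_integral_cong_AE) auto
    then show ?thesis using v 1 by simp
  next
    case 2
    then have "AE x in M. v x = 0" using v by (intro null) auto
    then have "(\<integral>\<^sup>+x. (u x + v x) powr r \<partial>M) = (\<integral>\<^sup>+x. u x powr r \<partial>M)"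
      by (intro nn_integral_cong_AE) auto
    then show ?thesis using u 2 by simp
  next
    case 3
    define t where "t = b / (a + b)"
    define c where "c = a + b"
    have t: "0 < t" "t < 1" "0 < c" using 3 by (auto simp: t_def c_def field_simps)
    have a: "a = c * (1 - t)" and b: "b = c * t" using 3 by (auto simp: t_def c_def field_simps)
    have "(\<integral>\<^sup>+x. (u x + v x) powr r \<partial>M)
      \<le> (\<integral>\<^sup>+x. ennreal (c powr r) * (ennreal ((1 - t) * a powr - r) * (u x powr r)
             + ennreal (t * b powr - r) * (v x powr r)) \<partial>M)"
    proof (intro nn_integral_mono)
      fix x
      have "u x + v x = c * ((1 - t) * (u x / a) + t * (v x / b))"
        using t 3 by (simp add: a b distrib_left)
      then have "(u x + v x) powr r = c powr r * ((1 - t) * (u x / a) + t * (v x / b)) powr r"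
        by (simp only: powr_mult)
      also have "\<dots> \<le> c powr r * ((1 - t) * (u x / a) powr r + t * (v x / b) powr r)"
        using assms t 3 by (intro mult_left_mono powr_convex_le) auto
      also have "\<dots> = c powr r * ((1 - t) * a powr - r * u x powr r + t * b powr - r * v x powr r)"
        by (simp add: powr_divide powr_minus field_simps)
      finally show "ennreal ((u x + v x) powr r) \<le> ennreal (c powr r) * (ennreal ((1 - t) * a powr - r) * (u x powr r)
             + ennreal (t * b powr - r) * (v x powr r))"
        using t by (subst ennreal_mult'[symmetric] ennreal_plus[symmetric] | simp)+ 
    qed
    also have "\<dots> = ennreal (c powr r) * (ennreal ((1 - t) * a powr - r) * (\<integral>\<^sup>+x. u x powr r \<partial>M)
             + ennreal (t * b powr - r) * (\<integral>\<^sup>+x. v x powr r \<partial>M))"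
      by (simp add: nn_integral_cmult nn_integral_add)
    also have "\<dots> \<le> ennreal (c powr r) * (ennreal ((1 - t) * a powr - r) * ennreal (a powr r)
             + ennreal (t * b powr - r) * ennreal (b powr r))"
      by (intro mult_left_mono add_mono u v) auto
    also have "\<dots> = ennreal (c powr r * ((1 - t) * a powr - r * a powr r + t * b powr - r * b powr r))"
      using t by (simp add: ennreal_mult' ennreal_plus)
    also have "c powr r * ((1 - t) * a powr - r * a powr r + t * b powr - r * b powr r) = (a + b) powr r"
      using t 3 by (simp add: powr_minus field_simps) (simp add: c_def add.commute)
    finally show ?thesis .
  qed
qed

section \<open>Hypercontractivity of multi-affine polynomials\<close>

text \<open>Indexing coefficients by sets of variables makes the polynomial affine in each variable,
  which is what kernels vanishing on diagonals produce.\<close>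

definition mpol :: "'i set \<Rightarrow> ('i set \<Rightarrow> real) \<Rightarrow> ('i \<Rightarrow> real) \<Rightarrow> real" where
  "mpol V a y = (\<Sum>S\<in>Pow V. a S * (\<Prod>i\<in>S. y i))"

lemma mpol_cong: "(\<And>i. i \<in> V \<Longrightarrow> y i = z i) \<Longrightarrow> mpol V a y = mpol V a z"
  unfolding mpol_def by (intro sum.cong refl arg_cong2[where f="(*)"] prod.cong) auto

text \<open>Expansion in the variable \<open>i\<close> about \<open>c\<close>: the first polynomial
  is \<open>mpol (insert i V) a\<close> with that variable frozen at \<open>c\<close>, the second is
  its slope. In the moment bounds \<open>c\<close> is the mean, so the second term is
  centered.\<close>

lemma mpol_insert:
  assumes "finite V" "i \<notin> V"
  shows "mpol (insert i V) a y = mpol V (\<lambda>S. a S + c * a (insert i S)) y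
           + mpol V (\<lambda>S. a (insert i S)) y * (y i - c)"
proof -
  have "mpol (insert i V) a y = mpol V a y + (\<Sum>S\<in>insert i ` Pow V. a S * (\<Prod>j\<in>S. y j))"
    unfolding mpol_def Pow_insert using assms by (intro sum.union_disjoint) auto
  also have "(\<Sum>S\<in>insert i ` Pow V. a S * (\<Prod>j\<in>S. y j))
      = (\<Sum>S\<in>Pow V. a (insert i S) * (\<Prod>j\<in>insert i S. y j))"
  proof (subst sum.reindex)
    show "inj_on (insert i) (Pow V)" using assms by (auto simp: inj_on_def)
  qed simp
  also have "\<dots> = (\<Sum>S\<in>Pow V. y i * (a (insert i S) * (\<Prod>j\<in>S. y j)))"
  proof (intro sum.cong refl)
    fix S assume "S \<in> Pow V"
    then have "finite S" "i \<notin> S" using assms finite_subset by auto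
    then show "a (insert i S) * (\<Prod>j\<in>insert i S. y j) = y i * (a (insert i S) * (\<Prod>j\<in>S. y j))" by simp
  qed
  also have "\<dots> = y i * mpol V (\<lambda>S. a (insert i S)) y" by (simp add: mpol_def sum_distrib_left)
  finally show ?thesis
    by (simp add: mpol_def algebra_simps sum.distrib sum_subtractf sum_distrib_left)
qed

lemma mpol_measurable:
  assumes "finite V" "V \<subseteq> J" and s: "\<And>i. i \<in> V \<Longrightarrow> sets (\<mu> i) = sets borel"
  shows "mpol V a \<in> borel_measurable (PiM J \<mu>)"
proof -
  have "(\<lambda>x. x i) \<in> borel_measurable (PiM J \<mu>)" if "i \<in> V" for i
    using measurable_component_singleton[of i J \<mu>] measurable_cong_sets[OF refl s[OF that]] that assms(2)
    by blast
  then show ?thesis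
    unfolding mpol_def[abs_def]
    by (intro borel_measurable_sum borel_measurable_times borel_measurable_const borel_measurable_prod) auto
qed

text \<open>Tonelli combined with \<open>mpol_insert\<close>: the induction step for the
  product-space integrals that follow.\<close>

lemma nn_integral_PiM_mpol_insert:
  fixes g :: "real \<Rightarrow> ennreal"
  assumes "\<And>i. prob_space (\<mu> i)" "\<And>i. sets (\<mu> i) = sets borel" "finite V" "i \<notin> V"
    and [measurable]: "g \<in> borel_measurable borel"
  shows "(\<integral>\<^sup>+x. g (mpol (insert i V) a x) \<partial>PiM (insert i V) \<mu>)
    = (\<integral>\<^sup>+x. \<integral>\<^sup>+y. g (mpol V (\<lambda>S. a S + c * a (insert i S)) x
           + mpol V (\<lambda>S. a (insert i S)) x * (y - c)) \<partial>\<mu> i \<partial>PiM V \<mu>)"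
proof -
  have upd: "mpol V b (x(i := y)) = mpol V b x" for b x and y :: real
  proof (intro mpol_cong)
    fix j assume "j \<in> V"
    then have "j \<noteq> i" using assms(4) by blast
    then show "(x(i := y)) j = x j" by simp
  qed
  interpret product_sigma_finite \<mu>
    by (intro product_sigma_finite.intro prob_space_imp_sigma_finite assms(1))
  have [measurable]: "mpol (insert i V) a \<in> borel_measurable (PiM (insert i V) \<mu>)"
    using assms by (intro mpol_measurable) auto
  have meas: "(\<lambda>x. g (mpol (insert i V) a x)) \<in> borel_measurable (PiM (insert i V) \<mu>)" by measurable
  show ?thesis
    unfolding product_nn_integral_insert[OF assms(3,4) meas]
    by (simp add: mpol_insert[OF assms(3,4), where c=c] upd)
qed

text \<open>The third conclusion is a lower bound by the squared mean, since \<open>mpol V a m\<close> is the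
  expectation of the polynomial; carrying it along avoids computing that expectation.\<close>
lemma mpol_moments:
  assumes P: "\<And>i. prob_space (\<mu> i)" "\<And>i. sets (\<mu> i) = sets borel" and "finite V"
    and "1 \<le> r" "1 \<le> \<kappa>" and v: "\<And>i. i \<in> V \<Longrightarrow> 0 \<le> v i"
    and sq: "\<And>i a b. i \<in> V \<Longrightarrow> (\<integral>\<^sup>+y. ennreal ((a + b * (y - m i))\<^sup>2) \<partial>\<mu> i) = ennreal (a\<^sup>2 + v i * b\<^sup>2)"
    and mom: "\<And>i a b. i \<in> V \<Longrightarrow>
       (\<integral>\<^sup>+y. ennreal (((a + b * (y - m i))\<^sup>2) powr r) \<partial>\<mu> i) \<le> (a\<^sup>2 + \<kappa> * (v i * b\<^sup>2)) powr r"
    and deg: "\<And>S. S \<subseteq> V \<Longrightarrow> q < card S \<Longrightarrow> a S = 0"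
  shows "\<exists>t\<ge>0. (\<integral>\<^sup>+x. ennreal ((mpol V a x)\<^sup>2) \<partial>PiM V \<mu>) = t
      \<and> (\<integral>\<^sup>+x. ennreal (((mpol V a x)\<^sup>2) powr r) \<partial>PiM V \<mu>) \<le> (\<kappa> ^ q * t) powr r
      \<and> (mpol V a m)\<^sup>2 \<le> t"
  using \<open>finite V\<close> v sq mom deg
proof (induction V arbitrary: q a)
  case empty
  interpret prob_space "PiM {} \<mu>" by (intro prob_space_PiM P)
  have "((a {})\<^sup>2) powr r \<le> (\<kappa> ^ q * (a {})\<^sup>2) powr r"
    using \<open>1 \<le> r\<close> \<open>1 \<le> \<kappa>\<close> by (intro powr_mono2) (auto simp: mult_le_cancel_right1 not_less)
  then show ?case by (intro exI[of _ "(a {})\<^sup>2"]) (auto simp: mpol_def emeasure_space_1)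
next
  case (insert i V)
  \<comment> \<open>\<open>A\<close> is the polynomial with variable \<open>i\<close> set to its
    mean, \<open>B\<close> the coefficient of the centered variable. \<open>A\<close> keeps the
    degree bound \<open>q\<close>; for \<open>B\<close> it drops by one.\<close>
  define A where "A = (\<lambda>S. a S + m i * a (insert i S))"
  define B where "B = (\<lambda>S. a (insert i S))"
  have card: "card (insert i S) = Suc (card S)" if "S \<subseteq> V" for S
    using insert.hyps that finite_subset by (subst card_insert_disjoint) auto
  have "A S = 0" if "S \<subseteq> V" "q < card S" for S
    using insert.prems(4)[of S] insert.prems(4)[of "insert i S"] card[of S] that
    by (auto simp: A_def subset_insertI2 insert_mono)
  then obtain s where s: "0 \<le> s" "(\<integral>\<^sup>+x. ennreal ((mpol V A x)\<^sup>2) \<partial>PiM V \<mu>) = s"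
      "(\<integral>\<^sup>+x. ennreal (((mpol V A x)\<^sup>2) powr r) \<partial>PiM V \<mu>) \<le> (\<kappa> ^ q * s) powr r" "(mpol V A m)\<^sup>2 \<le> s"
    using insert.IH[of q A] insert.prems by auto
  \<comment> \<open>The induction hypothesis for \<open>B\<close> gives the constant to the power
    \<open>q - 1\<close>, and the variable \<open>i\<close> contributes the missing factor. For
    \<open>q = 0\<close> the polynomial \<open>B\<close> vanishes.\<close>
  have "\<exists>u\<ge>0. (\<integral>\<^sup>+x. ennreal ((mpol V B x)\<^sup>2) \<partial>PiM V \<mu>) = u
      \<and> (\<integral>\<^sup>+x. ennreal ((\<kappa> * (v i * (mpol V B x)\<^sup>2)) powr r) \<partial>PiM V \<mu>) \<le> (\<kappa> ^ q * (v i * u)) powr r"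
  proof (cases q)
    case 0
    then have "B S = 0" if "S \<subseteq> V" for S
      using insert.prems(4)[of "insert i S"] card[of S] that by (auto simp: B_def insert_mono)
    then have "mpol V B x = 0" for x
      unfolding mpol_def by (intro sum.neutral) auto
    then show ?thesis by (intro exI[of _ 0]) simp
  next
    case (Suc p)
    have "B S = 0" if "S \<subseteq> V" "p < card S" for S
      using insert.prems(4)[of "insert i S"] card[of S] that Suc by (auto simp: B_def insert_mono)
    then obtain u where u: "0 \<le> u" "(\<integral>\<^sup>+x. ennreal ((mpol V B x)\<^sup>2) \<partial>PiM V \<mu>) = u"
        "(\<integral>\<^sup>+x. ennreal (((mpol V B x)\<^sup>2) powr r) \<partial>PiM V \<mu>) \<le> (\<kappa> ^ p * u) powr r"
      using insert.IH[of p B] insert.prems by auto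
    have "(\<integral>\<^sup>+x. ennreal ((\<kappa> * (v i * (mpol V B x)\<^sup>2)) powr r) \<partial>PiM V \<mu>)
       = (\<integral>\<^sup>+x. ennreal ((\<kappa> * v i) powr r) * ((mpol V B x)\<^sup>2) powr r \<partial>PiM V \<mu>)"
      by (simp add: powr_mult ennreal_mult' mult.assoc)
    also have "\<dots> = ennreal ((\<kappa> * v i) powr r) * (\<integral>\<^sup>+x. ennreal (((mpol V B x)\<^sup>2) powr r) \<partial>PiM V \<mu>)"
      using mpol_measurable[OF insert.hyps(1) order_refl P(2), of B] by (intro nn_integral_cmult) measurable
    also have "\<dots> \<le> ennreal ((\<kappa> * v i) powr r) * ennreal ((\<kappa> ^ p * u) powr r)"
      by (intro mult_left_mono u) auto
    also have "\<dots> = (\<kappa> ^ q * (v i * u)) powr r"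
      by (simp add: Suc powr_mult mult_ac flip: ennreal_mult')
    finally show ?thesis using u by auto
  qed
  then obtain u where u: "0 \<le> u" "(\<integral>\<^sup>+x. ennreal ((mpol V B x)\<^sup>2) \<partial>PiM V \<mu>) = u"
      "(\<integral>\<^sup>+x. ennreal ((\<kappa> * (v i * (mpol V B x)\<^sup>2)) powr r) \<partial>PiM V \<mu>) \<le> (\<kappa> ^ q * (v i * u)) powr r"
    by auto
  have vi: "0 \<le> v i" using insert.prems(1) by auto
  note [measurable] = mpol_measurable[OF insert.hyps(1) order_refl P(2), of A]
    mpol_measurable[OF insert.hyps(1) order_refl P(2), of B]
  note fold = nn_integral_PiM_mpol_insert[OF P insert.hyps(1,2), where c="m i" and a=a, folded A_def B_def]
  have "(\<integral>\<^sup>+x. ennreal ((mpol (insert i V) a x)\<^sup>2) \<partial>PiM (insert i V) \<mu>)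
      = (\<integral>\<^sup>+x. ennreal ((mpol V A x)\<^sup>2 + v i * (mpol V B x)\<^sup>2) \<partial>PiM V \<mu>)"
    by (subst fold) (simp_all add: insert.prems(2))
  also have "\<dots> = (\<integral>\<^sup>+x. ennreal ((mpol V A x)\<^sup>2) \<partial>PiM V \<mu>) + v i * (\<integral>\<^sup>+x. ennreal ((mpol V B x)\<^sup>2) \<partial>PiM V \<mu>)"
    using vi by (simp add: nn_integral_add nn_integral_cmult ennreal_mult')
  also have "\<dots> = ennreal (s + v i * u)"
    unfolding s(2) u(2) using s(1) u(1) vi by (simp add: ennreal_mult')
  finally have L2: "(\<integral>\<^sup>+x. ennreal ((mpol (insert i V) a x)\<^sup>2) \<partial>PiM (insert i V) \<mu>) = ennreal (s + v i * u)" .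
  have "(\<integral>\<^sup>+x. ennreal (((mpol (insert i V) a x)\<^sup>2) powr r) \<partial>PiM (insert i V) \<mu>)
      \<le> (\<integral>\<^sup>+x. ennreal (((mpol V A x)\<^sup>2 + \<kappa> * (v i * (mpol V B x)\<^sup>2)) powr r) \<partial>PiM V \<mu>)"
    by (subst fold) (auto intro!: nn_integral_mono insert.prems(3))
  \<comment> \<open>Minkowski adds the two bounds with constant 1, which keeps
    \<open>\<kappa> ^ q\<close> independent of the number of variables.\<close>
  also have "\<dots> \<le> (\<kappa> ^ q * s + \<kappa> ^ q * (v i * u)) powr r"
    using s u vi \<open>1 \<le> r\<close> \<open>1 \<le> \<kappa>\<close> by (intro Minkowski_powr) auto
  finally have Lr: "(\<integral>\<^sup>+x. ennreal (((mpol (insert i V) a x)\<^sup>2) powr r) \<partial>PiM (insert i V) \<mu>)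
      \<le> (\<kappa> ^ q * (s + v i * u)) powr r" by (simp add: distrib_left)
  have "mpol (insert i V) a m = mpol V A m"
    using mpol_insert[OF insert.hyps(1,2), of a m "m i"] by (simp add: A_def)
  then have "(mpol (insert i V) a m)\<^sup>2 \<le> s + v i * u" using s u vi by (simp add: add_increasing2)
  then show ?case using L2 Lr s(1) u(1) vi by (intro exI[of _ "s + v i * u"]) auto
qed

text \<open>Parseval's identity. The hypothesis \<open>sq\<close> encodes mean 0 and variance 1 of
  each variable, so expanding about \<open>c = 0\<close> leaves no cross term.\<close>

lemma mpol_orthonormal:
  assumes P: "\<And>i. prob_space (\<mu> i)" "\<And>i. sets (\<mu> i) = sets borel" and "finite V"
    and sq: "\<And>i a b. i \<in> V \<Longrightarrow> (\<integral>\<^sup>+y. ennreal ((a + b * y)\<^sup>2) \<partial>\<mu> i) = ennreal (a\<^sup>2 + b\<^sup>2)"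
  shows "(\<integral>\<^sup>+x. ennreal ((mpol V a x)\<^sup>2) \<partial>PiM V \<mu>) = ennreal (\<Sum>S\<in>Pow V. (a S)\<^sup>2)"
  using \<open>finite V\<close> sq
proof (induction V arbitrary: a)
  case empty
  interpret prob_space "PiM {} \<mu>" by (intro prob_space_PiM P)
  show ?case by (simp add: mpol_def emeasure_space_1)
next
  case (insert i V)
  note [measurable] = mpol_measurable[OF insert.hyps(1) order_refl P(2), of a]
    mpol_measurable[OF insert.hyps(1) order_refl P(2), of "\<lambda>S. a (insert i S)"]
  have "(\<integral>\<^sup>+x. ennreal ((mpol (insert i V) a x)\<^sup>2) \<partial>PiM (insert i V) \<mu>)
      = (\<integral>\<^sup>+x. ennreal ((mpol V a x)\<^sup>2 + (mpol V (\<lambda>S. a (insert i S)) x)\<^sup>2) \<partial>PiM V \<mu>)"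
    using insert.prems
    by (subst nn_integral_PiM_mpol_insert[OF P insert.hyps(1,2), where c=0 and a=a]) simp_all
  also have "\<dots> = ennreal ((\<Sum>S\<in>Pow V. (a S)\<^sup>2) + (\<Sum>S\<in>Pow V. (a (insert i S))\<^sup>2))"
    using insert.IH[of a] insert.IH[of "\<lambda>S. a (insert i S)"] insert.prems
    by (simp add: nn_integral_add sum_nonneg)
  also have "(\<Sum>S\<in>Pow V. (a (insert i S))\<^sup>2) = (\<Sum>S\<in>insert i ` Pow V. (a S)\<^sup>2)"
  proof (subst sum.reindex)
    show "inj_on (insert i) (Pow V)" using insert.hyps by (auto simp: inj_on_def)
  qed simp
  also have "(\<Sum>S\<in>Pow V. (a S)\<^sup>2) + \<dots> = (\<Sum>S\<in>Pow (insert i V). (a S)\<^sup>2)"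
    unfolding Pow_insert using insert.hyps by (intro sum.union_disjoint[symmetric]) auto
  finally show ?case .
qed

text \<open>By independence the joint law on \<open>V\<close> is the product law. The point mass at
  0 outside \<open>V\<close> is a filler: the product-space lemmas ask for a probability measure at
  every index.\<close>

lemma (in prob_space) indep_vars_nn_integral_mpol:
  fixes g :: "real \<Rightarrow> ennreal"
  assumes ind: "indep_vars (\<lambda>_. borel) W V" and "finite V" and [measurable]: "g \<in> borel_measurable borel"
  shows "(\<integral>\<^sup>+x. g (mpol V a (\<lambda>i. W i x)) \<partial>M)
    = (\<integral>\<^sup>+x. g (mpol V a x) \<partial>PiM V (\<lambda>i. if i \<in> V then distr M borel (W i) else return borel 0))"
proof (cases "V = {}")
  case True
  interpret E: prob_space "PiM {} (\<lambda>i. return borel (0::real))"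
    by (intro prob_space_PiM prob_space_return) auto
  show ?thesis using True by (simp add: mpol_def emeasure_space_1 E.emeasure_space_1)
next
  case False
  have rv: "\<And>i. i \<in> V \<Longrightarrow> W i \<in> borel_measurable M" using ind by (auto simp: indep_vars_def)
  have "distr M (PiM V (\<lambda>_. borel)) (\<lambda>x. \<lambda>i\<in>V. W i x) = PiM V (\<lambda>i. distr M borel (W i))"
    using ind indep_vars_iff_distr_eq_PiM'[OF False rv] by auto
  also have "\<dots> = PiM V (\<lambda>i. if i \<in> V then distr M borel (W i) else return borel 0)"
    by (intro PiM_cong) auto
  finally have eq: "distr M (PiM V (\<lambda>_. borel)) (\<lambda>x. \<lambda>i\<in>V. W i x)
    = PiM V (\<lambda>i. if i \<in> V then distr M borel (W i) else return borel 0)" .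
  have [measurable]: "mpol V a \<in> borel_measurable (PiM V (\<lambda>_. borel))"
    using \<open>finite V\<close> by (intro mpol_measurable) auto
  have meas: "(\<lambda>x. \<lambda>i\<in>V. W i x) \<in> measurable M (PiM V (\<lambda>_. borel))"
    using rv by (intro measurable_restrict)
  show ?thesis
    unfolding eq[symmetric] using meas
    by (subst nn_integral_distr) (auto intro!: nn_integral_cong arg_cong[where f=g] mpol_cong)
qed

lemma (in prob_space) nn_integral_affine_sq:
  fixes W :: "'a \<Rightarrow> real"
  assumes "integrable M W" "integrable M (\<lambda>x. (W x)\<^sup>2)" "expectation W = m"
    "expectation (\<lambda>x. (W x - m)\<^sup>2) = v"
  shows "(\<integral>\<^sup>+x. ennreal ((a + b * (W x - m))\<^sup>2) \<partial>M) = ennreal (a\<^sup>2 + v * b\<^sup>2)"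
proof -
  have i2: "integrable M (\<lambda>x. (W x - m)\<^sup>2)" using assms by (simp add: power2_diff)
  have eq: "(\<lambda>x. (a + b * (W x - m))\<^sup>2) = (\<lambda>x. a\<^sup>2 + 2 * a * b * (W x - m) + b\<^sup>2 * (W x - m)\<^sup>2)"
    by (auto simp: fun_eq_iff power2_eq_square algebra_simps)
  have "(\<integral>\<^sup>+x. ennreal ((a + b * (W x - m))\<^sup>2) \<partial>M) = (\<integral>x. (a + b * (W x - m))\<^sup>2 \<partial>M)"
    using i2 assms(1) by (intro nn_integral_eq_integral) (auto simp: eq)
  also have "(\<integral>x. (a + b * (W x - m))\<^sup>2 \<partial>M) = a\<^sup>2 + 2 * a * b * (\<integral>x. (W x - m) \<partial>M) + b\<^sup>2 * v"
    unfolding eq using i2 assms(1) prob_space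
    by (subst Bochner_Integration.integral_add) (auto simp: assms(4))
  also have "(\<integral>x. (W x - m) \<partial>M) = 0" using assms prob_space by simp
  finally show ?thesis by (simp add: mult.commute)
qed

text \<open>Hypercontractivity: a comparison of the higher moment with the variance, uniform over
  the single variables, passes to polynomials with a constant depending on \<open>K\<close> and the
  degree only.\<close>

lemma (in prob_space) indep_mpol_moments:
  assumes ind: "indep_vars (\<lambda>_. borel) W V" and "finite V"
    and r: "1 \<le> r" "r \<le> 2" "1 \<le> K"
    and int: "\<And>i. i \<in> V \<Longrightarrow> integrable M (W i)" "\<And>i. i \<in> V \<Longrightarrow> integrable M (\<lambda>x. (W i x)\<^sup>2)"
    and mean: "\<And>i. i \<in> V \<Longrightarrow> expectation (W i) = m i"
    and var: "\<And>i. i \<in> V \<Longrightarrow> expectation (\<lambda>x. (W i x - m i)\<^sup>2) = v i"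
    and mom: "\<And>i. i \<in> V \<Longrightarrow> (\<integral>\<^sup>+x. ennreal (((W i x - m i)\<^sup>2) powr r) \<partial>M) \<le> (K * v i) powr r"
    and deg: "\<And>S. S \<subseteq> V \<Longrightarrow> q < card S \<Longrightarrow> a S = 0"
  shows "\<exists>t\<ge>0. (\<integral>\<^sup>+x. ennreal ((mpol V a (\<lambda>i. W i x))\<^sup>2) \<partial>M) = t
      \<and> (\<integral>\<^sup>+x. ennreal (((mpol V a (\<lambda>i. W i x))\<^sup>2) powr r) \<partial>M) \<le> ((32 * K) ^ q * t) powr r
      \<and> (mpol V a m)\<^sup>2 \<le> t"
proof -
  define \<mu> where "\<mu> = (\<lambda>i. if i \<in> V then distr M borel (W i) else return borel 0)"
  have rv: "\<And>i. i \<in> V \<Longrightarrow> W i \<in> borel_measurable M" using ind by (auto simp: indep_vars_def)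
  have P: "prob_space (\<mu> i)" for i
    using rv by (auto simp: \<mu>_def intro: prob_space_distr prob_space_return)
  have sets: "sets (\<mu> i) = sets borel" for i by (auto simp: \<mu>_def)
  have v: "0 \<le> v i" if "i \<in> V" for i unfolding var[OF that, symmetric] by simp
  have sq: "(\<integral>\<^sup>+y. ennreal ((c + b * (y - m i))\<^sup>2) \<partial>\<mu> i) = ennreal (c\<^sup>2 + v i * b\<^sup>2)" if "i \<in> V" for i c b
    using nn_integral_affine_sq[OF int[OF that] mean[OF that] var[OF that]] that rv
    by (simp add: \<mu>_def nn_integral_distr)
  have "(\<integral>\<^sup>+y. ennreal (((c + b * (y - m i))\<^sup>2) powr r) \<partial>\<mu> i) \<le> (c\<^sup>2 + 32 * K * (v i * b\<^sup>2)) powr r"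
    if "i \<in> V" for i c b
    using that rv[OF that] int[OF that] mean[OF that] var[OF that] mom[OF that] v[OF that] r
    by (intro affine_moment_le P sets)
      (auto simp: \<mu>_def nn_integral_distr integral_distr integrable_distr_eq)
  then have "\<exists>t\<ge>0. (\<integral>\<^sup>+x. ennreal ((mpol V a x)\<^sup>2) \<partial>PiM V \<mu>) = t
      \<and> (\<integral>\<^sup>+x. ennreal (((mpol V a x)\<^sup>2) powr r) \<partial>PiM V \<mu>) \<le> ((32 * K) ^ q * t) powr r
      \<and> (mpol V a m)\<^sup>2 \<le> t"
    using r by (intro mpol_moments[where v=v] P sets \<open>finite V\<close> v sq deg) auto
  then show ?thesis
    using indep_vars_nn_integral_mpol[OF ind \<open>finite V\<close>, of "\<lambda>z. ennreal (z\<^sup>2)" a]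
      indep_vars_nn_integral_mpol[OF ind \<open>finite V\<close>, of "\<lambda>z. ennreal ((z\<^sup>2) powr r)" a]
    by (simp add: \<mu>_def)
qed

section \<open>From almost sure convergence to convergence in mean square\<close>

text \<open>Split the square of \<open>Z\<close> at \<open>t / 2\<close> and \<open>L * t\<close>,
  where \<open>L\<close> is the power in the bound. The part below \<open>t / 2\<close> contributes
  at most \<open>t / 2\<close> to the mean; the part above \<open>L * t\<close> contributes at most
  \<open>t / 4\<close> by the choice of \<open>L\<close>. The rest carries at least
  \<open>t / 4\<close> and is bounded by \<open>L * t\<close>, so its set has probability at least
  \<open>1 / (4 * L)\<close>.\<close>

lemma (in prob_space) Paley_Zygmund_powr:
  assumes [measurable]: "Z \<in> borel_measurable M" and "1 < r" "0 < K" "0 < t"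
    and L2: "(\<integral>\<^sup>+x. ennreal ((Z x)\<^sup>2) \<partial>M) = ennreal t" and Lr: "(\<integral>\<^sup>+x. ennreal (((Z x)\<^sup>2) powr r) \<partial>M) \<le> (K * t) powr r"
  shows "1 / (4 * (4 * K powr r) powr (1 / (r - 1))) \<le> prob {x \<in> space M. t / 2 \<le> (Z x)\<^sup>2}"
proof -
  define L where "L = (4 * K powr r) powr (1 / (r - 1))"
  define E where "E = {x \<in> space M. t / 2 \<le> (Z x)\<^sup>2}"
  have [measurable]: "E \<in> sets M" unfolding E_def by measurable
  have "0 < L" using \<open>0 < K\<close> by (simp add: L_def)
  have LK: "L powr (1 - r) * K powr r = 1 / 4"
  proof -
    have "L powr (1 - r) = (4 * K powr r) powr (- 1)"
    proof -
      have "1 / (r - 1) * (1 - r) = - 1" using \<open>1 < r\<close> by (simp add: field_simps)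
      then show ?thesis by (simp only: L_def powr_powr)
    qed
    then show ?thesis using \<open>0 < K\<close> by (simp add: powr_minus field_simps)
  qed
  have pt: "z \<le> t / 2 + L * t * indicator E x + (L * t) powr (1 - r) * z powr r"
    if "z = (Z x)\<^sup>2" "x \<in> space M" for x z
  proof (cases "z < t / 2 \<or> z \<le> L * t")
    case True
    have "0 \<le> (L * t) powr (1 - r) * z powr r" by simp
    moreover have "0 \<le> L * t" using \<open>0 < L\<close> \<open>0 < t\<close> by simp
    moreover have "z \<le> t / 2 + L * t * indicator E x"
      using True that \<open>0 < t\<close> \<open>0 \<le> L * t\<close> by (auto simp: E_def split: split_indicator)
    ultimately show ?thesis by linarith
  next
    case False
    then have "0 < L * t" "L * t \<le> z" using \<open>0 < L\<close> \<open>0 < t\<close> by auto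
    then have "z powr (1 - r) \<le> (L * t) powr (1 - r)"
      using \<open>1 < r\<close> by (intro powr_mono2') auto
    then have "z powr (1 - r) * z powr r \<le> (L * t) powr (1 - r) * z powr r"
      by (intro mult_right_mono) auto
    also have "z powr (1 - r) * z powr r = z" using \<open>0 < L * t\<close> \<open>L * t \<le> z\<close> by (simp flip: powr_add)
    finally have "z \<le> (L * t) powr (1 - r) * z powr r" .
    moreover have "0 \<le> t / 2 + L * t * indicator E x" using \<open>0 < L * t\<close> \<open>0 < t\<close> by simp
    ultimately show ?thesis by linarith
  qed
  have "ennreal t \<le> (\<integral>\<^sup>+x. ennreal (t / 2) + ennreal (L * t) * indicator E x
       + ennreal ((L * t) powr (1 - r)) * ((Z x)\<^sup>2) powr r \<partial>M)"
    unfolding L2[symmetric]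
  proof (intro nn_integral_mono)
    fix x assume "x \<in> space M"
    then have "ennreal ((Z x)\<^sup>2) \<le> ennreal (t / 2 + L * t * indicator E x + (L * t) powr (1 - r) * ((Z x)\<^sup>2) powr r)"
      by (intro ennreal_leI pt) auto
    also have "\<dots> = ennreal (t / 2) + ennreal (L * t) * indicator E x
       + ennreal ((L * t) powr (1 - r)) * ((Z x)\<^sup>2) powr r"
      using \<open>0 < L\<close> \<open>0 < t\<close> by (auto simp: ennreal_mult' split: split_indicator)
    finally show "ennreal ((Z x)\<^sup>2) \<le> \<dots>" .
  qed
  also have "\<dots> = ennreal (t / 2) + ennreal (L * t) * emeasure M E
       + ennreal ((L * t) powr (1 - r)) * (\<integral>\<^sup>+x. ennreal (((Z x)\<^sup>2) powr r) \<partial>M)"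
    by (simp add: nn_integral_add nn_integral_cmult emeasure_space_1)
  also have "\<dots> \<le> ennreal (t / 2) + ennreal (L * t) * emeasure M E
       + ennreal ((L * t) powr (1 - r)) * ennreal ((K * t) powr r)"
    by (intro add_mono mult_left_mono Lr) auto
  also have "\<dots> = ennreal (t / 2 + L * t * prob E + (L * t) powr (1 - r) * (K * t) powr r)"
    using \<open>0 < L\<close> \<open>0 < t\<close> by (simp add: emeasure_eq_measure ennreal_mult')
  finally have "t \<le> t / 2 + L * t * prob E + (L * t) powr (1 - r) * (K * t) powr r"
    using \<open>0 < L\<close> \<open>0 < t\<close> by (subst (asm) ennreal_le_iff) auto
  also have "(L * t) powr (1 - r) * (K * t) powr r = (L powr (1 - r) * K powr r) * (t powr (1 - r) * t powr r)"
    by (simp add: powr_mult)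
  also have "\<dots> = t / 4" using \<open>0 < t\<close> by (simp add: LK flip: powr_add)
  finally have "t \<le> t / 2 + L * t * prob E + t / 4" .
  then have "t * 1 \<le> t * (4 * L * prob E)" by argo
  then have "1 \<le> 4 * L * prob E" using \<open>0 < t\<close> by (simp only: mult_le_cancel_left_pos)
  then show ?thesis using \<open>0 < L\<close> unfolding L_def[symmetric] E_def[symmetric] by (simp add: field_simps)
qed

text \<open>Almost sure convergence gives convergence in probability by dominated convergence.
  Whenever \<open>t n \<ge> e\<close>, the Paley-Zygmund bound \<open>c\<close>, which is the same
  for all \<open>n\<close>, lies below the probability that the square of \<open>Z n\<close> reaches
  \<open>e / 2\<close>; this fails for large \<open>n\<close>.\<close>

lemma (in prob_space) AE_tendsto_0_imp_L2_tendsto_0: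
  assumes [measurable]: "\<And>n::nat. Z n \<in> borel_measurable M" and "1 < r" "0 < K" and "\<And>n. 0 \<le> t n"
    and L2: "\<And>n. (\<integral>\<^sup>+x. ennreal ((Z n x)\<^sup>2) \<partial>M) = ennreal (t n)"
    and Lr: "\<And>n. (\<integral>\<^sup>+x. ennreal (((Z n x)\<^sup>2) powr r) \<partial>M) \<le> (K * t n) powr r"
    and AE: "AE x in M. (\<lambda>n. Z n x) \<longlonglongrightarrow> 0"
  shows "t \<longlonglongrightarrow> 0"
proof (rule LIMSEQ_I)
  fix e :: real assume "0 < e"
  define c where "c = 1 / (4 * (4 * K powr r) powr (1 / (r - 1)))"
  have "0 < c" using \<open>0 < K\<close> by (simp add: c_def)
  have "AE x in M. (\<lambda>n. indicator {x \<in> space M. e / 2 \<le> (Z n x)\<^sup>2} x :: real) \<longlonglongrightarrow> 0"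
    using AE
  proof eventually_elim
    case (elim x)
    have "(\<lambda>n. (Z n x)\<^sup>2) \<longlonglongrightarrow> 0" using tendsto_power[OF elim, of 2] by simp
    then have "\<forall>\<^sub>F n in sequentially. (Z n x)\<^sup>2 < e / 2"
      by (rule order_tendstoD(2)) (use \<open>0 < e\<close> in simp)
    then have "\<forall>\<^sub>F n in sequentially. indicator {x \<in> space M. e / 2 \<le> (Z n x)\<^sup>2} x = (0::real)"
      by eventually_elim auto
    then show ?case by (rule tendsto_eventually)
  qed
  then have "(\<lambda>n. \<integral>x. indicator {x \<in> space M. e / 2 \<le> (Z n x)\<^sup>2} x \<partial>M) \<longlonglongrightarrow> (\<integral>x. (0::real) \<partial>M)"
    by (intro integral_dominated_convergence[where w="\<lambda>_. 1"]) (auto split: split_indicator)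
  then have "\<forall>\<^sub>F n in sequentially. prob {x \<in> space M. e / 2 \<le> (Z n x)\<^sup>2} < c"
    using \<open>0 < c\<close> by (intro order_tendstoD) (auto simp: Int_def conj_ac)
  then have "\<forall>\<^sub>F n in sequentially. t n < e"
  proof eventually_elim
    case (elim n)
    show ?case
    proof (rule ccontr)
      assume "\<not> t n < e"
      then have "c \<le> prob {x \<in> space M. t n / 2 \<le> (Z n x)\<^sup>2}"
        unfolding c_def using \<open>0 < e\<close> \<open>1 < r\<close> \<open>0 < K\<close> L2 Lr by (intro Paley_Zygmund_powr) auto
      also have "\<dots> \<le> prob {x \<in> space M. e / 2 \<le> (Z n x)\<^sup>2}"
        using \<open>\<not> t n < e\<close> by (intro finite_measure_mono) auto
      finally show False using elim by simp
    qed
  qed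
  then show "\<exists>no. \<forall>n\<ge>no. norm (t n - 0) < e"
    using assms(4) by (auto simp: eventually_sequentially)
qed

section \<open>Resampling\<close>

text \<open>The fresh randomness of one coordinate: a coin with success probability \<open>s\<close>
  and an independent draw from \<open>P\<close>. \<open>resample\<close> keeps the old value on
  success and takes the draw otherwise.\<close>

definition coin_pair :: "real \<Rightarrow> real measure \<Rightarrow> (bool \<times> real) measure" where
  "coin_pair s P = measure_pmf (bernoulli_pmf s) \<Otimes>\<^sub>M P"

definition resample :: "real \<Rightarrow> bool \<times> real \<Rightarrow> real" where
  "resample x z = (if fst z then x else snd z)"

lemma sets_coin_pair: "sets P = sets borel \<Longrightarrow> sets (coin_pair s P) = sets (count_space UNIV \<Otimes>\<^sub>M borel)"
  unfolding coin_pair_def by (intro sets_pair_measure_cong) auto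

lemma measurable_resample [measurable]:
  "(\<lambda>p. resample (fst p) (snd p)) \<in> borel_measurable (borel \<Otimes>\<^sub>M (count_space UNIV \<Otimes>\<^sub>M borel))"
  unfolding resample_def by measurable

lemma measurable_resample_coin_pair:
  assumes "sets P = sets borel"
  shows "resample x \<in> borel_measurable (coin_pair s P)"
proof -
  have "resample x \<in> borel_measurable (count_space UNIV \<Otimes>\<^sub>M borel)"
    unfolding resample_def[abs_def] by measurable
  then show ?thesis using measurable_cong_sets[OF sets_coin_pair[OF assms] refl] by blast
qed

lemma prob_space_coin_pair: "prob_space P \<Longrightarrow> prob_space (coin_pair s P)"
  unfolding coin_pair_def
  by (rule prob_space_pair) (auto intro: prob_space_measure_pmf)

lemma nn_integral_resample:
  assumes "prob_space P" "sets P = sets borel" "0 \<le> s" "s \<le> 1" and g: "g \<in> borel_measurable borel"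
  shows "(\<integral>\<^sup>+z. g (resample x z) \<partial>coin_pair s P) = ennreal s * g x + ennreal (1 - s) * (\<integral>\<^sup>+y. g y \<partial>P)"
proof -
  interpret P: prob_space P by fact
  have "(\<lambda>z. g (resample x z)) \<in> borel_measurable (coin_pair s P)"
    using measurable_resample_coin_pair[OF assms(2)] g by (rule measurable_compose)
  then have "(\<integral>\<^sup>+z. g (resample x z) \<partial>coin_pair s P)
     = (\<integral>\<^sup>+b. (\<integral>\<^sup>+y. g (resample x (b, y)) \<partial>P) \<partial>bernoulli_pmf s)"
    unfolding coin_pair_def by (rule P.nn_integral_fst[symmetric])
  also have "\<dots> = ennreal s * g x + ennreal (1 - s) * (\<integral>\<^sup>+y. g y \<partial>P)"
    using assms by (simp add: resample_def P.emeasure_space_1 mult.commute)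
  finally show ?thesis .
qed

lemma
  fixes g :: "real \<Rightarrow> real"
  assumes "prob_space P" "sets P = sets borel" "0 \<le> s" "s \<le> 1"
    and g: "g \<in> borel_measurable borel" "integrable P g"
  shows integrable_resample: "integrable (coin_pair s P) (\<lambda>z. g (resample x z))"
    and integral_resample: "(\<integral>z. g (resample x z) \<partial>coin_pair s P) = s * g x + (1 - s) * (\<integral>y. g y \<partial>P)"
proof -
  interpret P: prob_space P by fact
  interpret B: prob_space "measure_pmf (bernoulli_pmf s)" by (rule prob_space_measure_pmf)
  interpret pair_sigma_finite "measure_pmf (bernoulli_pmf s)" P ..
  show int: "integrable (coin_pair s P) (\<lambda>z. g (resample x z))"
  proof (rule integrableI_bounded)
    show "(\<lambda>z. g (resample x z)) \<in> borel_measurable (coin_pair s P)"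
      using measurable_resample_coin_pair[OF assms(2)] g(1) by (rule measurable_compose)
    have "(\<integral>\<^sup>+y. ennreal (norm (g y)) \<partial>P) < \<infinity>" using g by (simp add: integrable_iff_bounded)
    then show "(\<integral>\<^sup>+z. ennreal (norm (g (resample x z))) \<partial>coin_pair s P) < \<infinity>"
      using assms by (subst nn_integral_resample) (auto simp: ennreal_mult_less_top)
  qed
  have "(\<integral>z. g (resample x z) \<partial>coin_pair s P)
     = (\<integral>b. (\<integral>y. g (resample x (b, y)) \<partial>P) \<partial>bernoulli_pmf s)"
    unfolding coin_pair_def using int by (intro integral_fst'[symmetric]) (simp add: coin_pair_def)
  also have "\<dots> = s * g x + (1 - s) * (\<integral>y. g y \<partial>P)"
    using assms by (simp add: resample_def P.prob_space mult.commute)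
  finally show "(\<integral>z. g (resample x z) \<partial>coin_pair s P) = s * g x + (1 - s) * (\<integral>y. g y \<partial>P)" .
qed

text \<open>Each coordinate is either kept or replaced by an independent draw from its own law, so
  its law is a mixture of two equal laws; independence over the coordinates is preserved. By
  uniqueness of measures it suffices to check finite-dimensional cylinders.\<close>

lemma (in prob_space) distr_resample:
  fixes X :: "'i \<Rightarrow> 'a \<Rightarrow> real"
  assumes ind: "indep_vars (\<lambda>_. borel) X I" and "I \<noteq> {}" and s: "0 \<le> s" "s \<le> 1"
  defines "N \<equiv> PiM I (\<lambda>i. coin_pair s (distr M borel (X i)))"
  shows "distr (M \<Otimes>\<^sub>M N) (PiM I (\<lambda>_. borel)) (\<lambda>p. \<lambda>i\<in>I. resample (X i (fst p)) (snd p i))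
       = distr M (PiM I (\<lambda>_. borel)) (\<lambda>\<omega>. \<lambda>i\<in>I. X i \<omega>)" (is "?D = _")
    and "(\<lambda>p. \<lambda>i\<in>I. resample (X i (fst p)) (snd p i)) \<in> measurable (M \<Otimes>\<^sub>M N) (PiM I (\<lambda>_. borel))"
proof -
  define \<kappa> where "\<kappa> = (\<lambda>i. coin_pair s (distr M borel (X i)))"
  have N: "N = PiM I \<kappa>" by (simp add: N_def \<kappa>_def)
  have rv[measurable]: "\<And>i. i \<in> I \<Longrightarrow> X i \<in> borel_measurable M" using ind by (auto simp: indep_vars_def)
  have Pd: "prob_space (distr M borel (X i))" if "i \<in> I" for i by (intro prob_space_distr rv that)
  have P\<kappa>: "prob_space (\<kappa> i)" if "i \<in> I" for i
    unfolding \<kappa>_def by (intro prob_space_coin_pair Pd that)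
  interpret N: prob_space N unfolding N by (intro prob_space_PiM P\<kappa>)
  interpret MN: pair_prob_space M N ..
  have coord: "(\<lambda>p. snd p i) \<in> measurable (M \<Otimes>\<^sub>M N) (count_space UNIV \<Otimes>\<^sub>M borel)" if "i \<in> I" for i
  proof -
    have "(\<lambda>u. u i) \<in> measurable N (\<kappa> i)" unfolding N using that by measurable
    then have "(\<lambda>u. u i) \<in> measurable N (count_space UNIV \<Otimes>\<^sub>M borel)"
      using measurable_cong_sets[OF refl sets_coin_pair[of "distr M borel (X i)" s]] by (auto simp: \<kappa>_def)
    then show ?thesis by measurable
  qed
  show meas: "(\<lambda>p. \<lambda>i\<in>I. resample (X i (fst p)) (snd p i)) \<in> measurable (M \<Otimes>\<^sub>M N) (PiM I (\<lambda>_. borel))"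
  proof (intro measurable_restrict)
    fix i assume i: "i \<in> I"
    have "(\<lambda>p. (X i (fst p), snd p i)) \<in> measurable (M \<Otimes>\<^sub>M N) (borel \<Otimes>\<^sub>M (count_space UNIV \<Otimes>\<^sub>M borel))"
      using coord[OF i] rv[OF i] by measurable
    from measurable_compose[OF this measurable_resample]
    show "(\<lambda>p. resample (X i (fst p)) (snd p i)) \<in> borel_measurable (M \<Otimes>\<^sub>M N)" by simp
  qed
  have "?D = PiM I (\<lambda>i. distr M borel (X i))"
  proof (rule measure_eqI_PiM_infinite)
    show "sets ?D = sets (PiM I (\<lambda>i. distr M borel (X i)))" by (simp cong: sets_PiM_cong)
    show "finite_measure ?D" using MN.prob_space_distr[OF meas] by (simp add: prob_space.finite_measure)
    fix A J assume J: "finite J" "J \<subseteq> I" and A': "\<And>i. i \<in> J \<Longrightarrow> A i \<in> sets (distr M borel (X i))"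
    then have A[measurable]: "\<And>i. i \<in> J \<Longrightarrow> A i \<in> sets borel" by simp
    define E where "E = prod_emb I (\<lambda>i. distr M borel (X i)) J (Pi\<^sub>E J A)"
    \<comment> \<open>The conditional probability that the resampled coordinate falls into
      \<open>A i\<close>, given that its old value is \<open>y\<close>.\<close>
    define g where "g i y = s * indicator (A i) y + (1 - s) * prob (X i -` A i \<inter> space M)" for i and y :: real
    have E: "E = {y \<in> space (PiM I (\<lambda>_. borel)). \<forall>j\<in>J. y j \<in> A j}"
      using J by (auto simp: E_def prod_emb_def space_PiM PiE_def Pi_def extensional_def)
    have Em: "E \<in> sets (PiM I (\<lambda>_. borel))"
    proof -
      have "E \<in> sets (PiM I (\<lambda>i. distr M borel (X i)))"
        unfolding E_def using J A' by (intro sets_PiM_I) auto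
      then show ?thesis by (simp cong: sets_PiM_cong)
    qed
    have "emeasure ?D E = emeasure (M \<Otimes>\<^sub>M N)
        ((\<lambda>p. \<lambda>i\<in>I. resample (X i (fst p)) (snd p i)) -` E \<inter> space (M \<Otimes>\<^sub>M N))"
      using meas Em by (rule emeasure_distr)
    also have "\<dots> = (\<integral>\<^sup>+\<omega>. emeasure N (Pair \<omega> -`
        ((\<lambda>p. \<lambda>i\<in>I. resample (X i (fst p)) (snd p i)) -` E \<inter> space (M \<Otimes>\<^sub>M N))) \<partial>M)"
      by (rule N.emeasure_pair_measure_alt[OF measurable_sets[OF meas Em]])
    also have "\<dots> = (\<integral>\<^sup>+\<omega>. ennreal (\<Prod>j\<in>J. g j (X j \<omega>)) \<partial>M)"
    proof (intro nn_integral_cong)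
      fix \<omega> assume \<omega>: "\<omega> \<in> space M"
      define C where "C j = {z \<in> space (\<kappa> j). resample (X j \<omega>) z \<in> A j}" for j
      have rm: "resample (X j \<omega>) \<in> borel_measurable (\<kappa> j)" for j
        unfolding \<kappa>_def by (intro measurable_resample_coin_pair) simp
      have C: "C j \<in> sets (\<kappa> j)" if "j \<in> J" for j
        unfolding C_def using measurable_sets[OF rm A[OF that]] by (simp add: vimage_def Int_def conj_commute)
      have "Pair \<omega> -` ((\<lambda>p. \<lambda>i\<in>I. resample (X i (fst p)) (snd p i)) -` E \<inter> space (M \<Otimes>\<^sub>M N))
          = prod_emb I \<kappa> J (Pi\<^sub>E J C)"
        using \<omega> J by (auto simp: E C_def N prod_emb_def space_pair_measure space_PiM PiE_def Pi_def)
      then have "emeasure N (Pair \<omega> -` ((\<lambda>p. \<lambda>i\<in>I. resample (X i (fst p)) (snd p i)) -` E \<inter> space (M \<Otimes>\<^sub>M N)))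
          = (\<Prod>j\<in>J. emeasure (\<kappa> j) (C j))"
        unfolding N using J P\<kappa> C by (simp add: emeasure_PiM_emb)
      also have "\<dots> = (\<Prod>j\<in>J. ennreal (g j (X j \<omega>)))"
      proof (intro prod.cong refl)
        fix j assume j: "j \<in> J"
        then have jI: "j \<in> I" using J by auto
        have "emeasure (\<kappa> j) (C j) = (\<integral>\<^sup>+z. indicator (A j) (resample (X j \<omega>) z) \<partial>\<kappa> j)"
        proof -
          have "emeasure (\<kappa> j) (C j) = (\<integral>\<^sup>+z. indicator (C j) z \<partial>\<kappa> j)" using C[OF j] by simp
          also have "\<dots> = (\<integral>\<^sup>+z. indicator (A j) (resample (X j \<omega>) z) \<partial>\<kappa> j)"
            by (intro nn_integral_cong) (auto simp: C_def split: split_indicator)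
          finally show ?thesis .
        qed
        also have "\<dots> = ennreal s * indicator (A j) (X j \<omega>)
            + ennreal (1 - s) * (\<integral>\<^sup>+y. indicator (A j) y \<partial>distr M borel (X j))"
          unfolding \<kappa>_def using s j jI by (intro nn_integral_resample Pd) auto
        also have "(\<integral>\<^sup>+y. indicator (A j) y \<partial>distr M borel (X j)) = prob (X j -` A j \<inter> space M)"
          using j jI rv[OF jI] by (simp add: emeasure_distr emeasure_eq_measure)
        finally show "emeasure (\<kappa> j) (C j) = ennreal (g j (X j \<omega>))"
          using s by (simp add: g_def ennreal_mult' flip: ennreal_indicator)
      qed
      also have "\<dots> = ennreal (\<Prod>j\<in>J. g j (X j \<omega>))"
        using s by (intro prod_ennreal) (auto simp: g_def)
      finally show "emeasure N (Pair \<omega> -` ((\<lambda>p. \<lambda>i\<in>I. resample (X i (fst p)) (snd p i)) -` E \<inter> space (M \<Otimes>\<^sub>M N)))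
          = ennreal (\<Prod>j\<in>J. g j (X j \<omega>))" .
    qed
    also have "\<dots> = (\<integral>\<^sup>+\<omega>. (\<Prod>j\<in>J. ennreal (g j (X j \<omega>))) \<partial>M)"
      using s by (intro nn_integral_cong prod_ennreal[symmetric]) (auto simp: g_def)
    also have "\<dots> = (\<Prod>j\<in>J. \<integral>\<^sup>+\<omega>. ennreal (g j (X j \<omega>)) \<partial>M)"
    proof (rule indep_vars_nn_integral[OF J(1)])
      have gm: "(\<lambda>y. ennreal (g j y)) \<in> borel_measurable borel" if "j \<in> J" for j
        unfolding g_def using A[OF that] by measurable
      show "indep_vars (\<lambda>_. borel) (\<lambda>j \<omega>. ennreal (g j (X j \<omega>))) J"
        using gm by (intro indep_vars_compose2[OF indep_vars_subset[OF ind J(2)]])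
    qed simp
    \<comment> \<open>Averaging \<open>g\<close> over the old value turns the mixture into
      \<open>s * p + (1 - s) * p\<close>, where \<open>p\<close> is the probability that
      \<open>X j\<close> lies in \<open>A j\<close>.\<close>
    also have "\<dots> = (\<Prod>j\<in>J. emeasure (distr M borel (X j)) (A j))"
    proof (intro prod.cong refl)
      fix j assume j: "j \<in> J"
      then have jI: "j \<in> I" using J by auto
      have Xj[measurable]: "X j -` A j \<inter> space M \<in> sets M" using rv[OF jI] A[OF j] by measurable
      have "(\<integral>\<^sup>+\<omega>. ennreal (g j (X j \<omega>)) \<partial>M)
          = (\<integral>\<^sup>+\<omega>. ennreal s * indicator (X j -` A j \<inter> space M) \<omega>
               + ennreal (1 - s) * ennreal (prob (X j -` A j \<inter> space M)) \<partial>M)"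
        using s by (intro nn_integral_cong) (auto simp: g_def ennreal_mult' split: split_indicator)
      also have "\<dots> = ennreal (s * prob (X j -` A j \<inter> space M) + (1 - s) * prob (X j -` A j \<inter> space M))"
        using s by (simp add: nn_integral_add nn_integral_cmult prob_space emeasure_eq_measure ennreal_mult')
      also have "\<dots> = emeasure (distr M borel (X j)) (A j)"
        using rv[OF jI] A[OF j] by (simp add: emeasure_distr emeasure_eq_measure algebra_simps)
      finally show "(\<integral>\<^sup>+\<omega>. ennreal (g j (X j \<omega>)) \<partial>M) = emeasure (distr M borel (X j)) (A j)" .
    qed
    also have "\<dots> = emeasure (PiM I (\<lambda>i. distr M borel (X i))) E"
      unfolding E_def using J A' Pd by (intro emeasure_PiM_emb[symmetric]) auto
    finally show "emeasure ?D (prod_emb I (\<lambda>i. distr M borel (X i)) J (Pi\<^sub>E J A))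
      = emeasure (PiM I (\<lambda>i. distr M borel (X i))) (prod_emb I (\<lambda>i. distr M borel (X i)) J (Pi\<^sub>E J A))"
      unfolding E_def .
  qed simp
  also have "\<dots> = distr M (PiM I (\<lambda>_. borel)) (\<lambda>\<omega>. \<lambda>i\<in>I. X i \<omega>)"
    using ind indep_vars_iff_distr_eq_PiM'[OF \<open>I \<noteq> {}\<close> rv] by auto
  finally show "?D = distr M (PiM I (\<lambda>_. borel)) (\<lambda>\<omega>. \<lambda>i\<in>I. X i \<omega>)" .
qed

section \<open>Polynomials in the resampled variables\<close>

lemma sq_diff_scale_powr_le:
  fixes x y s r :: real
  assumes "0 < s" "s < 1" "1 \<le> r" "r \<le> 2"
  shows "((y - s * x)\<^sup>2) powr r \<le> 16 * ((y\<^sup>2) powr r + (x\<^sup>2) powr r)"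
proof -
  have "(s * x)\<^sup>2 \<le> x\<^sup>2" using assms by (simp add: power_mult_distrib mult_left_le_one_le power_le_one)
  moreover have "(y - s * x)\<^sup>2 \<le> 2 * y\<^sup>2 + 2 * (s * x)\<^sup>2"
    using zero_le_power2[of "y + s * x"] by (simp add: power2_diff power2_sum)
  ultimately have "(y - s * x)\<^sup>2 \<le> 4 * max (y\<^sup>2) (x\<^sup>2)" by simp
  then have "((y - s * x)\<^sup>2) powr r \<le> (4 * max (y\<^sup>2) (x\<^sup>2)) powr r" using assms by (intro powr_mono2) auto
  also have "\<dots> = 4 powr r * (max (y\<^sup>2) (x\<^sup>2)) powr r" by (rule powr_mult)
  also have "\<dots> \<le> 16 * (max (y\<^sup>2) (x\<^sup>2)) powr r"
    using powr_mono[of r 2 "4::real"] assms by (intro mult_right_mono) auto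
  also have "(max (y\<^sup>2) (x\<^sup>2)) powr r \<le> (y\<^sup>2) powr r + (x\<^sup>2) powr r" by (auto simp: max_def)
  finally show ?thesis by simp
qed

text \<open>The old values \<open>x\<close> are frozen, so the resampled variables are independent
  with means \<open>s * x i\<close>. Hypercontractivity applies once their centered moments are
  compared with their variances uniformly in \<open>i\<close>; the variance contributed by the coin
  makes this possible however large \<open>x i\<close> is.\<close>

lemma (in prob_space) mpol_resample_tendsto_0:
  fixes x :: "'i \<Rightarrow> real" and P :: "'i \<Rightarrow> real measure"
  assumes P: "\<And>i. i \<in> I \<Longrightarrow> prob_space (P i)" "\<And>i. i \<in> I \<Longrightarrow> sets (P i) = sets borel" and "I \<noteq> {}"
    and mean: "\<And>i. i \<in> I \<Longrightarrow> integrable (P i) (\<lambda>y. y)" "\<And>i. i \<in> I \<Longrightarrow> (\<integral>y. y \<partial>P i) = 0"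
    and var: "\<And>i. i \<in> I \<Longrightarrow> integrable (P i) (\<lambda>y. y\<^sup>2)" "\<And>i. i \<in> I \<Longrightarrow> (\<integral>y. y\<^sup>2 \<partial>P i) = 1"
    and mom: "\<And>i. i \<in> I \<Longrightarrow> (\<integral>\<^sup>+y. ennreal ((y\<^sup>2) powr r) \<partial>P i) \<le> ennreal C"
    and r: "1 < r" "r \<le> 2" and "0 \<le> C" and s: "0 < s" "s < 1"
    and V: "\<And>n::nat. finite (V n)" "\<And>n. V n \<subseteq> I"
    and deg: "\<And>n S. S \<subseteq> V n \<Longrightarrow> q < card S \<Longrightarrow> a n S = 0"
    and conv: "AE u in PiM I (\<lambda>i. coin_pair s (P i)).
      (\<lambda>n. mpol (V n) (a n) (\<lambda>i. resample (x i) (u i))) \<longlonglongrightarrow> 0"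
  shows "(\<lambda>n. mpol (V n) (a n) (\<lambda>i. s * x i)) \<longlonglongrightarrow> 0"
proof -
  define \<kappa> where "\<kappa> = (\<lambda>i. coin_pair s (P i))"
  define N where "N = PiM I \<kappa>"
  have P\<kappa>: "prob_space (\<kappa> i)" if "i \<in> I" for i
    unfolding \<kappa>_def by (intro prob_space_coin_pair P that)
  interpret N: prob_space N unfolding N_def by (intro prob_space_PiM P\<kappa>)
  define W where "W i u = resample (x i) (u i)" for i u
  have coord: "(\<lambda>u. u i) \<in> measurable N (\<kappa> i)" if "i \<in> I" for i
    unfolding N_def using that by measurable
  have rm: "resample (x i) \<in> borel_measurable (\<kappa> i)" if "i \<in> I" for i
    unfolding \<kappa>_def by (intro measurable_resample_coin_pair P that)
  have law: "distr N (\<kappa> i) (\<lambda>u. u i) = \<kappa> i" if "i \<in> I" for i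
    unfolding N_def by (intro distr_PiM_component P\<kappa> that)
  \<comment> \<open>Coordinates of a product space are independent: their joint map is the identity
    there, so its law is the product of the marginals.\<close>
  have "distr N (PiM I \<kappa>) (\<lambda>u. \<lambda>i\<in>I. u i) = distr N N (\<lambda>u. u)"
    by (intro distr_cong) (auto simp: N_def space_PiM)
  also have "\<dots> = PiM I (\<lambda>i. distr N (\<kappa> i) (\<lambda>u. u i))"
    using law by (simp add: N_def cong: PiM_cong)
  finally have "N.indep_vars \<kappa> (\<lambda>i u. u i) I"
    using N.indep_vars_iff_distr_eq_PiM'[OF \<open>I \<noteq> {}\<close> coord] by auto
  then have "N.indep_vars (\<lambda>_. borel) W I"
    unfolding W_def by (rule N.indep_vars_compose2) (rule rm)
  then have indW: "N.indep_vars (\<lambda>_. borel) W (V n)" for n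
    using V(2) by (rule N.indep_vars_subset)
  have W_nn: "(\<integral>\<^sup>+u. g (W i u) \<partial>N) = ennreal s * g (x i) + ennreal (1 - s) * (\<integral>\<^sup>+y. g y \<partial>P i)"
    if i: "i \<in> I" and g: "g \<in> borel_measurable borel" for i and g :: "real \<Rightarrow> ennreal"
  proof -
    have "(\<integral>\<^sup>+u. g (W i u) \<partial>N) = (\<integral>\<^sup>+z. g (resample (x i) z) \<partial>distr N (\<kappa> i) (\<lambda>u. u i))"
      unfolding W_def using measurable_compose[OF rm[OF i] g]
      by (intro nn_integral_distr[symmetric] coord i) (auto simp: o_def)
    also have "\<dots> = (\<integral>\<^sup>+z. g (resample (x i) z) \<partial>\<kappa> i)" by (simp add: law[OF i])
    finally show ?thesis
      unfolding \<kappa>_def using P[OF i] s g by (simp add: nn_integral_resample)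
  qed
  have W_int: "integrable N (\<lambda>u. g (W i u))"
    and W_L: "(\<integral>u. g (W i u) \<partial>N) = s * g (x i) + (1 - s) * (\<integral>y. g y \<partial>P i)"
    if i: "i \<in> I" and g: "g \<in> borel_measurable borel" "integrable (P i) g" for i and g :: "real \<Rightarrow> real"
  proof -
    have gm: "(\<lambda>z. g (resample (x i) z)) \<in> borel_measurable (\<kappa> i)"
      using measurable_compose[OF rm[OF i] g(1)] by (simp add: o_def)
    have int: "integrable (\<kappa> i) (\<lambda>z. g (resample (x i) z))"
      unfolding \<kappa>_def using P[OF i] s g by (intro integrable_resample) auto
    then show "integrable N (\<lambda>u. g (W i u))"
      using integrable_distr_eq[OF coord[OF i] gm] by (simp add: law[OF i] W_def)
    have "(\<integral>u. g (W i u) \<partial>N) = (\<integral>z. g (resample (x i) z) \<partial>\<kappa> i)"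
      using integral_distr[OF coord[OF i] gm] by (simp add: law[OF i] W_def)
    then show "(\<integral>u. g (W i u) \<partial>N) = s * g (x i) + (1 - s) * (\<integral>y. g y \<partial>P i)"
      unfolding \<kappa>_def using P[OF i] s g by (simp add: integral_resample)
  qed
  \<comment> \<open>\<open>v i\<close> is the variance \<open>s * x^2 + (1 - s) - (s * x)^2\<close>
    with \<open>x\<close> for \<open>x i\<close>. \<open>D\<close> bounds the higher moment relative
    to \<open>(1 + x^2) powr r\<close>. Since \<open>v i\<close> is at least
    \<open>s * (1 - s) * (1 + x^2)\<close>, dividing \<open>D\<close> by \<open>s * (1 - s)\<close>
    gives a \<open>K\<close> that depends on neither \<open>i\<close> nor \<open>x\<close>.\<close>
  define v where "v i = s * (1 - s) * (x i)\<^sup>2 + (1 - s)" for i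
  define D where "D = 17 + 16 * C"
  define K where "K = D / (s * (1 - s))"
  have D: "1 \<le> D" using \<open>0 \<le> C\<close> by (simp add: D_def)
  have K: "1 \<le> K"
  proof -
    have "s * (1 - s) \<le> 1 * 1" using s by (intro mult_mono) auto
    then show ?thesis using s D by (simp add: K_def field_simps)
  qed
  have W1: "integrable N (W i)" "N.expectation (W i) = s * x i" if "i \<in> I" for i
    using W_int[OF that measurable_ident_sets[OF refl] mean(1)[OF that]]
      W_L[OF that measurable_ident_sets[OF refl] mean(1)[OF that]] mean(2)[OF that] by simp_all
  have sq: "(\<lambda>y::real. y\<^sup>2) \<in> borel_measurable borel" by measurable
  have W2: "integrable N (\<lambda>u. (W i u)\<^sup>2)" "N.expectation (\<lambda>u. (W i u)\<^sup>2) = s * (x i)\<^sup>2 + (1 - s)"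
    if "i \<in> I" for i
    using W_int[OF that sq var(1)[OF that]] W_L[OF that sq var(1)[OF that]] var(2)[OF that] by simp_all
  have Wv: "N.expectation (\<lambda>u. (W i u - s * x i)\<^sup>2) = v i" if i: "i \<in> I" for i
  proof -
    have "N.expectation (\<lambda>u. (W i u - s * x i)\<^sup>2)
        = N.expectation (\<lambda>u. (W i u)\<^sup>2 - 2 * s * x i * W i u + (s * x i)\<^sup>2)"
      by (intro Bochner_Integration.integral_cong) (auto simp: power2_eq_square algebra_simps)
    also have "\<dots> = v i"
      using W1[OF i] W2[OF i] N.prob_space
      by (simp add: v_def) (simp add: power2_eq_square algebra_simps)
    finally show ?thesis .
  qed
  have Wr: "(\<integral>\<^sup>+u. ennreal (((W i u - s * x i)\<^sup>2) powr r) \<partial>N) \<le> ennreal ((K * v i) powr r)" if i: "i \<in> I" for i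
  proof -
    define b where "b = ((x i)\<^sup>2) powr r"
    have b: "0 \<le> b" by (simp add: b_def)
    have bound: "(\<integral>\<^sup>+y. ennreal (((y - s * x i)\<^sup>2) powr r) \<partial>P i) \<le> ennreal (16 * (C + b))"
    proof -
      interpret Pi: prob_space "P i" by (intro P i)
      have [measurable_cong]: "sets (P i) = sets borel" by (intro P i)
      have "(\<integral>\<^sup>+y. ennreal (((y - s * x i)\<^sup>2) powr r) \<partial>P i)
         \<le> (\<integral>\<^sup>+y. ennreal 16 * (ennreal ((y\<^sup>2) powr r) + ennreal b) \<partial>P i)"
      proof (intro nn_integral_mono)
        fix y
        have "ennreal (((y - s * x i)\<^sup>2) powr r) \<le> ennreal (16 * ((y\<^sup>2) powr r + b))"
          unfolding b_def using s r by (intro ennreal_leI sq_diff_scale_powr_le) auto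
        also have "\<dots> = ennreal 16 * (ennreal ((y\<^sup>2) powr r) + ennreal b)"
          using b by (simp add: ennreal_mult')
        finally show "ennreal (((y - s * x i)\<^sup>2) powr r) \<le> \<dots>" .
      qed
      also have "\<dots> = ennreal 16 * ((\<integral>\<^sup>+y. ennreal ((y\<^sup>2) powr r) \<partial>P i) + ennreal b)"
        by (simp add: nn_integral_cmult nn_integral_add Pi.emeasure_space_1)
      also have "\<dots> \<le> ennreal 16 * (ennreal C + ennreal b)"
        by (intro mult_left_mono add_mono mom i) auto
      also have "\<dots> = ennreal (16 * (C + b))" using b \<open>0 \<le> C\<close> by (simp add: ennreal_mult')
      finally show ?thesis .
    qed
    have "(\<integral>\<^sup>+u. ennreal (((W i u - s * x i)\<^sup>2) powr r) \<partial>N)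
        = ennreal s * ennreal (((x i - s * x i)\<^sup>2) powr r)
          + ennreal (1 - s) * (\<integral>\<^sup>+y. ennreal (((y - s * x i)\<^sup>2) powr r) \<partial>P i)"
      by (intro W_nn[OF i, of "\<lambda>y. ennreal (((y - s * x i)\<^sup>2) powr r)"]) measurable
    also have "\<dots> \<le> ennreal 1 * ennreal b + ennreal 1 * ennreal (16 * (C + b))"
    proof (intro add_mono mult_mono bound ennreal_leI)
      have "(x i - s * x i)\<^sup>2 = (1 - s)\<^sup>2 * (x i)\<^sup>2" by (simp add: power2_eq_square algebra_simps)
      also have "\<dots> \<le> (x i)\<^sup>2" using s by (intro mult_left_le_one_le power_le_one) auto
      finally show "((x i - s * x i)\<^sup>2) powr r \<le> b"
        unfolding b_def using r by (intro powr_mono2) auto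
    qed (use s in auto)
    also have "\<dots> = ennreal (17 * b + 16 * C)" using b \<open>0 \<le> C\<close> by (simp flip: ennreal_plus)
    also have "17 * b + 16 * C \<le> (K * v i) powr r"
    proof -
      have "b \<le> (1 + (x i)\<^sup>2) powr r" unfolding b_def using r by (intro powr_mono2) auto
      moreover have "1 \<le> (1 + (x i)\<^sup>2) powr r" using r by (simp add: ge_one_powr_ge_zero)
      ultimately have "17 * b + 16 * C * 1 \<le> 17 * (1 + (x i)\<^sup>2) powr r + 16 * C * (1 + (x i)\<^sup>2) powr r"
        using \<open>0 \<le> C\<close> by (intro add_mono mult_left_mono) auto
      also have "\<dots> = D * (1 + (x i)\<^sup>2) powr r" by (simp add: D_def distrib_right)
      also have "\<dots> \<le> D powr r * (1 + (x i)\<^sup>2) powr r"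
        using powr_mono[of 1 r D] r D by (intro mult_right_mono) auto
      also have "\<dots> = (D * (1 + (x i)\<^sup>2)) powr r" by (simp add: powr_mult)
      also have "\<dots> \<le> (K * v i) powr r"
      proof (intro powr_mono2)
        have "s * (1 - s) \<le> 1 * (1 - s)" using s by (intro mult_right_mono) auto
        then have "s * (1 - s) * (1 + (x i)\<^sup>2) \<le> v i"
          by (simp add: v_def distrib_left)
        then have "K * (s * (1 - s) * (1 + (x i)\<^sup>2)) \<le> K * v i" using K by (intro mult_left_mono) auto
        then show "D * (1 + (x i)\<^sup>2) \<le> K * v i" using s by (simp add: K_def)
      qed (use r D in auto)
      finally show ?thesis by simp
    qed
    finally show ?thesis by (simp add: ennreal_leI)
  qed
  have "\<exists>t\<ge>0. (\<integral>\<^sup>+u. ennreal ((mpol (V n) (a n) (\<lambda>i. W i u))\<^sup>2) \<partial>N) = ennreal t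
      \<and> (\<integral>\<^sup>+u. ennreal (((mpol (V n) (a n) (\<lambda>i. W i u))\<^sup>2) powr r) \<partial>N) \<le> ennreal (((32 * K) ^ q * t) powr r)
      \<and> (mpol (V n) (a n) (\<lambda>i. s * x i))\<^sup>2 \<le> t" for n
    using V(2)[of n] r K
    by (intro N.indep_mpol_moments[where v=v] indW V W1 W2 Wv Wr deg) auto
  then obtain t where t: "\<And>n. 0 \<le> t n"
    "\<And>n. (\<integral>\<^sup>+u. ennreal ((mpol (V n) (a n) (\<lambda>i. W i u))\<^sup>2) \<partial>N) = ennreal (t n)"
    "\<And>n. (\<integral>\<^sup>+u. ennreal (((mpol (V n) (a n) (\<lambda>i. W i u))\<^sup>2) powr r) \<partial>N) \<le> ennreal (((32 * K) ^ q * t n) powr r)"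
    "\<And>n. (mpol (V n) (a n) (\<lambda>i. s * x i))\<^sup>2 \<le> t n"
    by metis
  have Wm: "W i \<in> borel_measurable N" if "i \<in> I" for i using W1(1)[OF that] by auto
  have "t \<longlonglongrightarrow> 0"
  proof (rule N.AE_tendsto_0_imp_L2_tendsto_0[OF _ r(1) _ t(1,2,3)])
    show "(\<lambda>u. mpol (V n) (a n) (\<lambda>i. W i u)) \<in> borel_measurable N" for n
      unfolding mpol_def using V(2)[of n] Wm
      by (intro borel_measurable_sum borel_measurable_times borel_measurable_const borel_measurable_prod) auto
    show "0 < (32 * K) ^ q" using K by simp
    show "AE u in N. (\<lambda>n. mpol (V n) (a n) (\<lambda>i. W i u)) \<longlonglongrightarrow> 0"
      using conv unfolding N_def \<kappa>_def W_def .
  qed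
  \<comment> \<open>The squared polynomial at the means is at most its second moment
    \<open>t n\<close>.\<close>
  then have "(\<lambda>n. (mpol (V n) (a n) (\<lambda>i. s * x i))\<^sup>2) \<longlonglongrightarrow> 0"
    using t(4) by (intro tendsto_sandwich[OF _ _ tendsto_const \<open>t \<longlonglongrightarrow> 0\<close>]) auto
  then have "(\<lambda>n. sqrt ((mpol (V n) (a n) (\<lambda>i. s * x i))\<^sup>2)) \<longlonglongrightarrow> sqrt 0" by (rule tendsto_real_sqrt)
  then show ?thesis by (simp add: tendsto_rabs_zero_iff)
qed

text \<open>The resampled sequence has the law of \<open>X\<close>, so the assumed convergence holds
  for it too. By Fubini it then holds, for almost every outcome of \<open>X\<close>, almost surely
  in the fresh randomness, and \<open>mpol_resample_tendsto_0\<close> passes to the conditional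
  means \<open>s * X i\<close>.\<close>

lemma (in prob_space) mpol_scale_tendsto_0:
  fixes X :: "'i \<Rightarrow> 'a \<Rightarrow> real"
  assumes ind: "indep_vars (\<lambda>_. borel) X I" and "I \<noteq> {}"
    and mean: "\<And>i. i \<in> I \<Longrightarrow> integrable M (X i)" "\<And>i. i \<in> I \<Longrightarrow> expectation (X i) = 0"
    and var: "\<And>i. i \<in> I \<Longrightarrow> integrable M (\<lambda>\<omega>. (X i \<omega>)\<^sup>2)" "\<And>i. i \<in> I \<Longrightarrow> expectation (\<lambda>\<omega>. (X i \<omega>)\<^sup>2) = 1"
    and mom: "\<And>i. i \<in> I \<Longrightarrow> (\<integral>\<^sup>+\<omega>. ennreal (((X i \<omega>)\<^sup>2) powr r) \<partial>M) \<le> ennreal C"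
    and r: "1 < r" "r \<le> 2" and "0 \<le> C" and s: "0 < s" "s < 1"
    and V: "\<And>n::nat. finite (V n)" "\<And>n. V n \<subseteq> I"
    and deg: "\<And>n S. S \<subseteq> V n \<Longrightarrow> q < card S \<Longrightarrow> a n S = 0"
    and conv: "AE \<omega> in M. (\<lambda>n. mpol (V n) (a n) (\<lambda>i. X i \<omega>)) \<longlonglongrightarrow> 0"
  shows "AE \<omega> in M. (\<lambda>n. mpol (V n) (a n) (\<lambda>i. s * X i \<omega>)) \<longlonglongrightarrow> 0"
proof -
  define N where "N = PiM I (\<lambda>i. coin_pair s (distr M borel (X i)))"
  have rv[measurable]: "\<And>i. i \<in> I \<Longrightarrow> X i \<in> borel_measurable M" using mean(1) by auto
  have Pd: "prob_space (distr M borel (X i))" if "i \<in> I" for i by (intro prob_space_distr rv that)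
  interpret N: prob_space N
    unfolding N_def by (intro prob_space_PiM prob_space_coin_pair Pd)
  interpret MN: pair_prob_space M N ..
  note resample = distr_resample[OF ind \<open>I \<noteq> {}\<close> less_imp_le[OF s(1)] less_imp_le[OF s(2)], folded N_def]
  let ?pred = "\<lambda>y. (\<lambda>n. mpol (V n) (a n) y) \<longlonglongrightarrow> 0"
  have pm: "{y \<in> space (PiM I (\<lambda>_. borel)). ?pred y} \<in> sets (PiM I (\<lambda>_. borel))"
  proof -
    have [measurable]: "mpol (V n) (a n) \<in> borel_measurable (PiM I (\<lambda>_. borel))" for n
      by (intro mpol_measurable V) auto
    show ?thesis by measurable
  qed
  have restr: "mpol (V n) (a n) (\<lambda>i\<in>I. y i) = mpol (V n) (a n) y" for n and y :: "'i \<Rightarrow> real"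
    using V(2)[of n] by (intro mpol_cong) auto
  have Xm: "(\<lambda>\<omega>. \<lambda>i\<in>I. X i \<omega>) \<in> measurable M (PiM I (\<lambda>_. borel))" by measurable
  \<comment> \<open>Almost sure convergence is an event of the sequence space, so it depends on the
    law of the sequence alone and can be pulled back along the resampling map.\<close>
  have "AE y in distr M (PiM I (\<lambda>_. borel)) (\<lambda>\<omega>. \<lambda>i\<in>I. X i \<omega>). ?pred y"
    using conv by (subst AE_distr_iff[OF Xm pm]) (simp add: restr)
  then have "AE p in M \<Otimes>\<^sub>M N. ?pred (\<lambda>i. resample (X i (fst p)) (snd p i))"
    unfolding resample(1)[symmetric] by (subst (asm) AE_distr_iff[OF resample(2) pm]) (simp add: restr)
  then have "AE \<omega> in M. AE u in N. ?pred (\<lambda>i. resample (X i \<omega>) (u i))"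
    using MN.AE_pair by fastforce
  then show ?thesis
  proof eventually_elim
    case (elim \<omega>)
    show ?case
    proof (rule mpol_resample_tendsto_0[OF Pd _ \<open>I \<noteq> {}\<close> _ _ _ _ _ r \<open>0 \<le> C\<close> s V deg elim[unfolded N_def]])
    qed (use mean var mom rv in \<open>auto simp: integrable_distr_eq integral_distr nn_integral_distr\<close>)
  qed
qed

section \<open>Homogeneous sums as limits in mean square\<close>

lemma AE_summable_of_nn_integral:
  fixes d :: "nat \<Rightarrow> 'a \<Rightarrow> real"
  assumes [measurable]: "\<And>n. d n \<in> borel_measurable M" and nn: "\<And>n x. 0 \<le> d n x"
    and le: "\<And>n. (\<integral>\<^sup>+x. ennreal (d n x) \<partial>M) \<le> ennreal ((1 / 2) ^ n)"
  shows "AE x in M. summable (\<lambda>n. d n x)"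
proof -
  have "(\<integral>\<^sup>+x. (\<Sum>n. ennreal (d n x)) \<partial>M) = (\<Sum>n. \<integral>\<^sup>+x. ennreal (d n x) \<partial>M)"
    by (intro nn_integral_suminf) measurable
  also have "\<dots> \<le> (\<Sum>n. ennreal ((1 / 2) ^ n))" by (intro suminf_le le) auto
  also have "\<dots> = ennreal (\<Sum>n. (1 / 2) ^ n)"
    by (rule suminf_ennreal2) (auto intro: summable_geometric)
  finally have "(\<integral>\<^sup>+x. (\<Sum>n. ennreal (d n x)) \<partial>M) \<noteq> \<infinity>" by (auto simp: top_unique)
  then have "AE x in M. (\<Sum>n. ennreal (d n x)) \<noteq> \<infinity>" by (intro nn_integral_PInf_AE) auto
  then show ?thesis
    by eventually_elim (auto intro!: summable_suminf_not_top nn)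
qed

text \<open>The sum of the squares has finite mean, hence is almost surely finite, and its terms
  tend to 0.\<close>

lemma AE_tendsto_0_of_L2_summable:
  fixes u :: "nat \<Rightarrow> 'a \<Rightarrow> real"
  assumes [measurable]: "\<And>n. u n \<in> borel_measurable M"
    and le: "\<And>n. (\<integral>\<^sup>+x. ennreal ((u n x)\<^sup>2) \<partial>M) \<le> ennreal ((1 / 2) ^ n)"
  shows "AE x in M. (\<lambda>n. u n x) \<longlonglongrightarrow> 0"
proof -
  have "AE x in M. summable (\<lambda>n. (u n x)\<^sup>2)"
    using le by (intro AE_summable_of_nn_integral) auto
  then show ?thesis
  proof eventually_elim
    case (elim x)
    then have "(\<lambda>n. sqrt ((u n x)\<^sup>2)) \<longlonglongrightarrow> sqrt 0"
      by (intro tendsto_real_sqrt summable_LIMSEQ_zero)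
    then show ?case by (simp add: tendsto_rabs_zero_iff)
  qed
qed

text \<open>Completeness of the space of square-integrable functions: a rapidly converging
  subsequence has an almost sure limit, and Fatou's lemma makes it the mean-square limit of the full
  sequence.\<close>

lemma (in prob_space) L2_Cauchy_imp_convergent:
  fixes u :: "nat \<Rightarrow> 'a \<Rightarrow> real" and \<sigma> :: "nat \<Rightarrow> real"
  assumes [measurable]: "\<And>n. u n \<in> borel_measurable M"
    and le: "\<And>m n. m \<le> n \<Longrightarrow> (\<integral>\<^sup>+x. ennreal ((u n x - u m x)\<^sup>2) \<partial>M) \<le> ennreal (\<sigma> n - \<sigma> m)"
    and \<sigma>: "\<sigma> \<longlonglongrightarrow> L" "\<And>n. \<sigma> n \<le> L"
  shows "\<exists>G\<in>borel_measurable M. (\<lambda>n. \<integral>\<^sup>+x. ennreal ((G x - u n x)\<^sup>2) \<partial>M) \<longlonglongrightarrow> 0"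
proof -
  \<comment> \<open>Squared increments of order \<open>(1 / 4) ^ j\<close> along \<open>k\<close>
    give increments in absolute mean of order \<open>(1 / 2) ^ j\<close>, which are
    summable.\<close>
  have "\<exists>k. \<forall>j. k j < k (Suc j) \<and> L - \<sigma> (k j) < (1 / 4) ^ j"
  proof (rule exI, rule allI)
    define P where "P j n \<longleftrightarrow> L - \<sigma> n < (1 / 4) ^ j" for j :: nat and n
    have ev: "\<exists>n>m. P j n" for m j
    proof -
      have "(\<lambda>n. L - \<sigma> n) \<longlonglongrightarrow> 0" using tendsto_diff[OF tendsto_const[of L] \<sigma>(1)] by simp
      then have "\<forall>\<^sub>F n in sequentially. P j n" unfolding P_def by (rule order_tendstoD) simp
      then have "\<forall>\<^sub>F n in sequentially. P j n \<and> m < n"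
        using eventually_gt_at_top by (rule eventually_conj)
      then show ?thesis by (metis (mono_tags, lifting) eventually_happens' sequentially_bot)
    qed
    define k where "k = rec_nat (SOME n. P 0 n) (\<lambda>j m. SOME n. m < n \<and> P (Suc j) n)"
    have "P j (k j) \<and> k j < k (Suc j)" for j
    proof (intro conjI)
      show "P j (k j)"
        by (cases j) (use someI_ex[of "P 0"] ev[of _ 0] someI_ex[OF ev] in \<open>auto simp: k_def\<close>)
      show "k j < k (Suc j)" using someI_ex[OF ev[of "k j" "Suc j"]] by (simp add: k_def)
    qed
    then show "k j < k (Suc j) \<and> L - \<sigma> (k j) < (1 / 4) ^ j" for j unfolding P_def by auto
  qed
  then obtain k where k: "\<And>j. k j < k (Suc j)" "\<And>j. L - \<sigma> (k j) < (1 / 4) ^ j" by auto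
  have mono: "strict_mono k" using k(1) by (rule strict_mono_Suc_iff[THEN iffD2, rule_format])
  define d where "d j x = u (k (Suc j)) x - u (k j) x" for j x
  have [measurable]: "d j \<in> borel_measurable M" for j unfolding d_def by measurable
  have "(\<integral>\<^sup>+x. ennreal \<bar>d j x\<bar> \<partial>M) \<le> ennreal ((1 / 2) ^ j)" for j
  proof -
    \<comment> \<open>Arithmetic-geometric mean inequality, weighted by \<open>2 ^ j\<close> so that
      both terms integrate to at most half of \<open>(1 / 2) ^ j\<close>.\<close>
    have "ennreal \<bar>d j x\<bar> \<le> ennreal ((1 / 2) ^ j / 2) + ennreal (2 ^ j / 2) * ennreal ((d j x)\<^sup>2)" for x
    proof -
      have "0 \<le> (2 ^ j * \<bar>d j x\<bar> - 1)\<^sup>2" by simp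
      then have "2 * (2 ^ j * \<bar>d j x\<bar>) \<le> 1 + 2 ^ j * 2 ^ j * (d j x)\<^sup>2"
        by (simp add: power2_diff power_mult_distrib) (simp add: power2_eq_square)
      then have "\<bar>d j x\<bar> \<le> (1 / 2) ^ j / 2 + 2 ^ j / 2 * (d j x)\<^sup>2"
        by (simp add: power_divide field_simps)
      then have "ennreal \<bar>d j x\<bar> \<le> ennreal ((1 / 2) ^ j / 2 + 2 ^ j / 2 * (d j x)\<^sup>2)" by (rule ennreal_leI)
      also have "\<dots> = ennreal ((1 / 2) ^ j / 2) + ennreal (2 ^ j / 2) * ennreal ((d j x)\<^sup>2)"
        by (subst ennreal_plus) (auto simp flip: ennreal_mult')
      finally show ?thesis .
    qed
    then have "(\<integral>\<^sup>+x. ennreal \<bar>d j x\<bar> \<partial>M)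
      \<le> (\<integral>\<^sup>+x. ennreal ((1 / 2) ^ j / 2) + ennreal (2 ^ j / 2) * ennreal ((d j x)\<^sup>2) \<partial>M)"
      by (intro nn_integral_mono)
    also have "\<dots> = ennreal ((1 / 2) ^ j / 2) + ennreal (2 ^ j / 2) * (\<integral>\<^sup>+x. ennreal ((d j x)\<^sup>2) \<partial>M)"
      by (simp add: nn_integral_add nn_integral_cmult emeasure_space_1)
    also have "(\<integral>\<^sup>+x. ennreal ((d j x)\<^sup>2) \<partial>M) \<le> ennreal (\<sigma> (k (Suc j)) - \<sigma> (k j))"
      unfolding d_def using k(1)[of j] by (intro le) simp
    also have "\<dots> \<le> ennreal ((1 / 4) ^ j)"
      using \<sigma>(2)[of "k (Suc j)"] k(2)[of j] by (intro ennreal_leI) simp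
    also have "ennreal ((1 / 2) ^ j / 2) + ennreal (2 ^ j / 2) * ennreal ((1 / 4) ^ j)
       = ennreal ((1 / 2) ^ j / 2 + 2 ^ j / 2 * (1 / 4) ^ j)"
      by (subst ennreal_plus) (auto simp flip: ennreal_mult')
    also have "(1 / 2) ^ j / 2 + 2 ^ j / 2 * (1 / 4) ^ j = (1 / 2 :: real) ^ j"
      by (simp flip: power_mult_distrib)
    finally show ?thesis by (simp add: add_left_mono mult_left_mono)
  qed
  then have "AE x in M. summable (\<lambda>j. \<bar>d j x\<bar>)"
    by (intro AE_summable_of_nn_integral) auto
  then have conv: "AE x in M. (\<lambda>j. u (k j) x) \<longlonglongrightarrow> lim (\<lambda>j. u (k j) x)"
  proof eventually_elim
    case (elim x)
    then have "summable (\<lambda>j. d j x)" by (rule summable_rabs_cancel)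
    then have "convergent (\<lambda>n. \<Sum>j<n. d j x)" by (simp add: summable_iff_convergent)
    moreover have "(\<Sum>j<n. d j x) = u (k n) x - u (k 0) x" for n
      unfolding d_def by (rule sum_lessThan_telescope)
    ultimately have "convergent (\<lambda>n. (u (k n) x - u (k 0) x) + u (k 0) x)"
      by (intro convergent_add convergent_const) simp
    then show ?case by (simp add: convergent_LIMSEQ_iff)
  qed
  \<comment> \<open>\<open>lim\<close> is total, so \<open>G\<close> is defined and measurable
    everywhere; off the convergence set, up to a null set the whole space, its value is
    arbitrary.\<close>
  define G where "G x = lim (\<lambda>j. u (k j) x)" for x
  have G[measurable]: "G \<in> borel_measurable M" unfolding G_def by measurable
  have bound: "(\<integral>\<^sup>+x. ennreal ((G x - u n x)\<^sup>2) \<partial>M) \<le> ennreal (L - \<sigma> n)" for n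
  proof -
    \<comment> \<open>Fatou along the subsequence with \<open>n\<close> fixed: as soon as
      \<open>n \<le> k j\<close>, the integrals are at most \<open>L - \<sigma> n\<close>.\<close>
    have "AE x in M. ennreal ((G x - u n x)\<^sup>2) = liminf (\<lambda>j. ennreal ((u (k j) x - u n x)\<^sup>2))"
      using conv
    proof eventually_elim
      case (elim x)
      then have "(\<lambda>j. ennreal ((u (k j) x - u n x)\<^sup>2)) \<longlonglongrightarrow> ennreal ((G x - u n x)\<^sup>2)"
        unfolding G_def by (intro tendsto_intros)
      from lim_imp_Liminf[OF _ this] show ?case by simp
    qed
    then have "(\<integral>\<^sup>+x. ennreal ((G x - u n x)\<^sup>2) \<partial>M)
        = (\<integral>\<^sup>+x. liminf (\<lambda>j. ennreal ((u (k j) x - u n x)\<^sup>2)) \<partial>M)" by (rule nn_integral_cong_AE)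
    also have "\<dots> \<le> liminf (\<lambda>j. \<integral>\<^sup>+x. ennreal ((u (k j) x - u n x)\<^sup>2) \<partial>M)"
      by (intro nn_integral_liminf) measurable
    also have "\<dots> \<le> limsup (\<lambda>j. \<integral>\<^sup>+x. ennreal ((u (k j) x - u n x)\<^sup>2) \<partial>M)"
      by (rule Liminf_le_Limsup) simp
    also have "\<dots> \<le> ennreal (L - \<sigma> n)"
    proof (rule Limsup_bounded)
      show "\<forall>\<^sub>F j in sequentially. (\<integral>\<^sup>+x. ennreal ((u (k j) x - u n x)\<^sup>2) \<partial>M) \<le> ennreal (L - \<sigma> n)"
      proof (rule eventually_sequentiallyI[of n])
        fix j assume "n \<le> j"
        then have "n \<le> k j" using seq_suble[OF mono, of j] by simp
        then have "(\<integral>\<^sup>+x. ennreal ((u (k j) x - u n x)\<^sup>2) \<partial>M) \<le> ennreal (\<sigma> (k j) - \<sigma> n)" by (rule le)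
        also have "\<dots> \<le> ennreal (L - \<sigma> n)" using \<sigma>(2)[of "k j"] by (intro ennreal_leI) simp
        finally show "(\<integral>\<^sup>+x. ennreal ((u (k j) x - u n x)\<^sup>2) \<partial>M) \<le> ennreal (L - \<sigma> n)" .
      qed
    qed
    finally show ?thesis .
  qed
  have "(\<lambda>n. \<integral>\<^sup>+x. ennreal ((G x - u n x)\<^sup>2) \<partial>M) \<longlonglongrightarrow> 0"
  proof (rule tendsto_sandwich[OF _ _ tendsto_const])
    show "\<forall>\<^sub>F n in sequentially. (\<integral>\<^sup>+x. ennreal ((G x - u n x)\<^sup>2) \<partial>M) \<le> ennreal (L - \<sigma> n)"
      by (intro always_eventually allI bound)
    have "(\<lambda>n. ennreal (L - \<sigma> n)) \<longlonglongrightarrow> ennreal (L - L)" by (intro tendsto_intros \<sigma>(1))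
    then show "(\<lambda>n. ennreal (L - \<sigma> n)) \<longlonglongrightarrow> 0" by simp
  qed simp
  then show ?thesis using G by blast
qed

section \<open>Recovering the coefficients of a polynomial from its values\<close>

text \<open>The degree stays fixed while \<open>n\<close> grows, so coefficients are fixed linear
  combinations of values. The sample points \<open>(1 / 2) ^ k\<close> are countably many, which
  later lets their null sets be united, and their geometric spacing allows elimination of one
  coefficient at a time.\<close>

lemma polynomial_coeffs_tendsto_0:
  fixes c :: "nat \<Rightarrow> nat \<Rightarrow> real"
  assumes "\<And>k. 1 \<le> k \<Longrightarrow> (\<lambda>n. \<Sum>p\<le>q. ((1 / 2) ^ k) ^ p * c p n) \<longlonglongrightarrow> 0"
    and "p \<le> q"
  shows "c p \<longlonglongrightarrow> 0"
  using assms
proof (induction q arbitrary: c p)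
  case 0
  from 0(1)[of 1] 0(2) show ?case by simp
next
  case (Suc q)
  \<comment> \<open>Passing from \<open>s\<close> to \<open>s / 2\<close> and rescaling by \<open>2 ^ Suc q\<close> cancels the top coefficient.\<close>
  define b where "b p n = (2 ^ (Suc q - p) - 1) * c p n" for p n
  have "(\<lambda>n. \<Sum>p\<le>q. ((1 / 2) ^ k) ^ p * b p n) \<longlonglongrightarrow> 0" if "1 \<le> k" for k
  proof -
    have eq: "2 ^ Suc q * (\<Sum>p\<le>Suc q. ((1 / 2) ^ Suc k) ^ p * c p n) - (\<Sum>p\<le>Suc q. ((1 / 2) ^ k) ^ p * c p n)
      = (\<Sum>p\<le>q. ((1 / 2) ^ k) ^ p * b p n)" for n
    proof -
      have "2 ^ Suc q * (((1 / 2) ^ Suc k) ^ p * c p n) - ((1 / 2) ^ k) ^ p * c p n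
          = ((1 / 2) ^ k) ^ p * b p n" if "p \<le> Suc q" for p
      proof -
        have "(2::real) ^ Suc q * (1 / 2) ^ p = 2 ^ (Suc q - p)"
          using that by (simp add: power_diff power_divide)
        moreover have "((1 / 2 :: real) ^ Suc k) ^ p = (1 / 2) ^ p * ((1 / 2) ^ k) ^ p"
          by (simp only: power_Suc power_mult_distrib)
        ultimately have "2 ^ Suc q * ((1 / 2 :: real) ^ Suc k) ^ p = 2 ^ (Suc q - p) * ((1 / 2) ^ k) ^ p"
          by (simp only: mult.assoc[symmetric])
        then show ?thesis by (simp only: b_def mult.assoc[symmetric]) (simp only: algebra_simps)
      qed
      then have "2 ^ Suc q * (\<Sum>p\<le>Suc q. ((1 / 2) ^ Suc k) ^ p * c p n) - (\<Sum>p\<le>Suc q. ((1 / 2) ^ k) ^ p * c p n)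
        = (\<Sum>p\<le>Suc q. ((1 / 2) ^ k) ^ p * b p n)"
        unfolding sum_distrib_left sum_subtractf[symmetric] by (intro sum.cong) auto
      then show ?thesis by (simp add: b_def)
    qed
    have "(\<lambda>n. 2 ^ Suc q * (\<Sum>p\<le>Suc q. ((1 / 2) ^ Suc k) ^ p * c p n) - (\<Sum>p\<le>Suc q. ((1 / 2) ^ k) ^ p * c p n))
        \<longlonglongrightarrow> 2 ^ Suc q * 0 - 0"
      by (intro tendsto_diff tendsto_mult tendsto_const Suc.prems(1) that le_SucI)
    then show ?thesis unfolding eq by simp
  qed
  then have b: "b p \<longlonglongrightarrow> 0" if "p \<le> q" for p using Suc.IH that by blast
  have lower: "c p \<longlonglongrightarrow> 0" if "p \<le> q" for p
  proof -
    have "(2::real) ^ 0 < 2 ^ (Suc q - p)" using that by (intro power_strict_increasing) auto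
    then have "c p = (\<lambda>n. b p n / (2 ^ (Suc q - p) - 1))" by (simp add: b_def)
    moreover have "(\<lambda>n. b p n / (2 ^ (Suc q - p) - 1)) \<longlonglongrightarrow> 0" using b[OF that] by (rule tendsto_divide_zero)
    ultimately show ?thesis by simp
  qed
  show ?case
  proof (cases "p \<le> q")
    case False
    then have p: "p = Suc q" using Suc.prems by simp
    \<comment> \<open>The lower coefficients are settled, so subtracting them from the value at
      \<open>1 / 2\<close> isolates the top one.\<close>
    have "(\<lambda>n. (\<Sum>p\<le>Suc q. ((1 / 2) ^ 1) ^ p * c p n) - (\<Sum>p\<le>q. ((1 / 2) ^ 1) ^ p * c p n)) \<longlonglongrightarrow> 0 - (\<Sum>p\<le>q. ((1 / 2) ^ 1) ^ p * 0)"
      by (intro tendsto_intros Suc.prems(1) lower) auto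
    then have "(\<lambda>n. (1 / 2) ^ p * c p n) \<longlonglongrightarrow> 0" by (simp add: p)
    then have "(\<lambda>n. 2 ^ p * ((1 / 2) ^ p * c p n)) \<longlonglongrightarrow> 2 ^ p * 0" by (intro tendsto_intros)
    then show ?thesis by (simp add: power_divide)
  qed (rule lower)
qed

section \<open>Partial homogeneous sums as multi-affine polynomials\<close>

text \<open>\<open>Qp_partial\<close> with a deterministic argument in place of the random
  variables, so that the argument can be rescaled.\<close>

definition hsum :: "nat \<Rightarrow> (nat list \<Rightarrow> real) \<Rightarrow> nat \<Rightarrow> (nat \<Rightarrow> real) \<Rightarrow> real" where
  "hsum p f N y = (\<Sum>l\<in>{l. length l = p \<and> set l \<subseteq> {1..N}}. f l * prod_list (map y l))"

text \<open>Collects the orderings of a finite \<open>S\<close> into one coefficient: for a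
  symmetric kernel, the factorial of \<open>card S\<close> times the common value.\<close>

definition setcoeff :: "('i list \<Rightarrow> real) \<Rightarrow> 'i set \<Rightarrow> real" where
  "setcoeff f S = (\<Sum>l\<in>{l. distinct l \<and> set l = S}. f l)"

lemma Qp_partial_hsum: "Qp_partial p f X N \<omega> = hsum p f N (\<lambda>i. X i \<omega>)"
  by (simp add: Qp_partial_def hsum_def)

lemma measurable_Qp_partial:
  assumes "\<And>i. i \<ge> 1 \<Longrightarrow> X i \<in> borel_measurable M"
  shows "Qp_partial p f X N \<in> borel_measurable M"
proof -
  have "(\<lambda>\<omega>. prod_list (map (\<lambda>i. X i \<omega>) l)) \<in> borel_measurable M" if "set l \<subseteq> {1..N}" for l
    using that by (induction l) (auto intro!: borel_measurable_times assms)
  then show ?thesis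
    unfolding Qp_partial_def[abs_def]
    by (intro borel_measurable_sum borel_measurable_times borel_measurable_const) auto
qed

lemma finite_lists_upto: "finite {l :: nat list. length l = p \<and> set l \<subseteq> {1..N}}"
  using finite_lists_length_eq[of "{1..N}" p] by (simp add: conj_commute)

lemma sum_distinct_lists:
  fixes g :: "nat list \<Rightarrow> real"
  assumes "\<And>l. length l = p \<Longrightarrow> set l \<subseteq> {1..N} \<Longrightarrow> \<not> distinct l \<Longrightarrow> g l = 0"
  shows "(\<Sum>l\<in>{l. length l = p \<and> set l \<subseteq> {1..N}}. g l)
    = (\<Sum>S\<in>Pow {1..N}. if card S = p then \<Sum>l\<in>{l. distinct l \<and> set l = S}. g l else 0)"
proof -
  define L where "L = {l. length l = p \<and> set l \<subseteq> {1..N} \<and> distinct l}"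
  have fin: "finite L" by (rule finite_subset[OF _ finite_lists_upto[of p N]]) (auto simp: L_def)
  have "(\<Sum>l\<in>{l. length l = p \<and> set l \<subseteq> {1..N}}. g l) = (\<Sum>l\<in>L. g l)"
    using assms by (intro sum.mono_neutral_right finite_lists_upto) (auto simp: L_def)
  also have "\<dots> = (\<Sum>S\<in>Pow {1..N}. \<Sum>l\<in>{l \<in> L. set l = S}. g l)"
    by (rule sum.group[symmetric, OF fin]) (auto simp: L_def)
  also have "\<dots> = (\<Sum>S\<in>Pow {1..N}. if card S = p then \<Sum>l\<in>{l. distinct l \<and> set l = S}. g l else 0)"
  proof (intro sum.cong refl)
    fix S assume "S \<in> Pow {1..N}"
    then have "{l \<in> L. set l = S} = (if card S = p then {l. distinct l \<and> set l = S} else {})"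
      by (auto simp: L_def distinct_card)
    then show "(\<Sum>l\<in>{l \<in> L. set l = S}. g l) = (if card S = p then \<Sum>l\<in>{l. distinct l \<and> set l = S}. g l else 0)"
      by simp
  qed
  finally show ?thesis .
qed

text \<open>A kernel vanishing on diagonals leaves only monomials without repeated variables, and
  these are grouped by their set of indices.\<close>

lemma hsum_mpol:
  assumes "\<And>l. length l = p \<Longrightarrow> set l \<subseteq> {1..N} \<Longrightarrow> \<not> distinct l \<Longrightarrow> f l = 0"
  shows "hsum p f N y = mpol {1..N} (\<lambda>S. if card S = p then setcoeff f S else 0) y"
proof -
  have "hsum p f N y = (\<Sum>S\<in>Pow {1..N}. if card S = p then
      \<Sum>l\<in>{l. distinct l \<and> set l = S}. f l * prod_list (map y l) else 0)"
    unfolding hsum_def using assms by (intro sum_distinct_lists) auto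
  also have "\<dots> = mpol {1..N} (\<lambda>S. if card S = p then setcoeff f S else 0) y"
    unfolding mpol_def
  proof (intro sum.cong refl)
    fix S :: "nat set"
    have "(\<Sum>l\<in>{l. distinct l \<and> set l = S}. f l * prod_list (map y l))
        = (\<Sum>l\<in>{l. distinct l \<and> set l = S}. f l * (\<Prod>i\<in>S. y i))"
      by (intro sum.cong refl) (auto simp: prod.distinct_set_conv_list)
    then show "(if card S = p then \<Sum>l\<in>{l. distinct l \<and> set l = S}. f l * prod_list (map y l) else 0)
        = (if card S = p then setcoeff f S else 0) * (\<Prod>i\<in>S. y i)"
      by (simp add: setcoeff_def sum_distrib_right)
  qed
  finally show ?thesis .
qed

lemma hsum_diff: "hsum p f N y - hsum p g N y = hsum p (\<lambda>l. f l - g l) N y"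
  by (simp add: hsum_def left_diff_distrib sum_subtractf)

lemma hsum_scale: "hsum p f N (\<lambda>i. s * y i) = s ^ p * hsum p f N y"
proof -
  have "prod_list (map (\<lambda>i. s * y i) l) = s ^ length l * prod_list (map y l)" for l
    by (induction l) auto
  then show ?thesis
    unfolding hsum_def sum_distrib_left by (intro sum.cong refl) (auto simp: mult_ac)
qed

text \<open>An increment of partial sums is again a partial sum, with the kernel cut off on the
  smaller cube; the second moment bound therefore applies to increments.\<close>

lemma hsum_restrict:
  assumes "m \<le> n"
  shows "hsum p f n y - hsum p f m y = hsum p (\<lambda>l. if set l \<subseteq> {1..m} then 0 else f l) n y"
proof -
  have "hsum p f m y = hsum p (\<lambda>l. if set l \<subseteq> {1..m} then f l else 0) n y"
    unfolding hsum_def using assms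
    by (intro sum.mono_neutral_cong_left finite_lists_upto) auto
  then show ?thesis
    unfolding hsum_def by (simp add: sum_subtractf[symmetric]) (intro sum.cong; simp)
qed

text \<open>Cauchy-Schwarz over the orderings of \<open>S\<close>, whose number is crudely bounded
  by \<open>p ^ p\<close>.\<close>

lemma setcoeff_sq_le:
  assumes "finite S" "card S = p"
  shows "(setcoeff f S)\<^sup>2 \<le> real p ^ p * (\<Sum>l\<in>{l. distinct l \<and> set l = S}. (f l)\<^sup>2)"
proof -
  let ?A = "{l. distinct l \<and> set l = S}" and ?B = "{l. set l \<subseteq> S \<and> length l = p}"
  have sub: "?A \<subseteq> ?B" using assms by (auto simp: distinct_card)
  have fin: "finite ?B" using assms by (simp add: finite_lists_length_eq)
  have "card ?A \<le> card ?B" by (rule card_mono[OF fin sub])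
  also have "card ?B = p ^ p" using card_lists_length_eq[OF assms(1), of p] assms by simp
  finally have card: "real (card ?A) \<le> real p ^ p" by (simp flip: of_nat_power)
  have "(setcoeff f S)\<^sup>2 \<le> (\<Sum>l\<in>?A. (f l)\<^sup>2) * real (card ?A)"
    unfolding setcoeff_def by (rule sum_squared_le_sum_of_squares)
  also have "\<dots> \<le> (\<Sum>l\<in>?A. (f l)\<^sup>2) * real p ^ p" by (intro mult_left_mono card sum_nonneg) auto
  finally show ?thesis by (simp add: mult.commute)
qed

text \<open>Monomials over different sets are orthonormal, so the second moment is the sum of the
  squared set coefficients; \<open>setcoeff_sq_le\<close> leads back to the kernel.\<close>

lemma (in prob_space) hsum_L2_le:
  assumes ind: "indep_vars (\<lambda>_. borel) X {1..}"
    and mean: "\<And>i. i \<ge> 1 \<Longrightarrow> integrable M (X i)" "\<And>i. i \<ge> 1 \<Longrightarrow> expectation (X i) = 0"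
    and var: "\<And>i. i \<ge> 1 \<Longrightarrow> integrable M (\<lambda>\<omega>. (X i \<omega>)\<^sup>2)" "\<And>i. i \<ge> 1 \<Longrightarrow> expectation (\<lambda>\<omega>. (X i \<omega>)\<^sup>2) = 1"
    and f: "\<And>l. length l = p \<Longrightarrow> set l \<subseteq> {1..N} \<Longrightarrow> \<not> distinct l \<Longrightarrow> f l = 0"
  shows "(\<integral>\<^sup>+\<omega>. ennreal ((hsum p f N (\<lambda>i. X i \<omega>))\<^sup>2) \<partial>M)
    \<le> ennreal (real p ^ p * (\<Sum>l\<in>{l. length l = p \<and> set l \<subseteq> {1..N}}. (f l)\<^sup>2))"
proof -
  define a where "a S = (if card S = p then setcoeff f S else 0)" for S
  define \<mu> where "\<mu> = (\<lambda>i. if i \<in> {1..N} then distr M borel (X i) else return borel 0)"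
  have rv: "\<And>i. i \<ge> 1 \<Longrightarrow> X i \<in> borel_measurable M" using mean(1) by auto
  have "indep_vars (\<lambda>_. borel) X {1..N}" by (rule indep_vars_subset[OF ind]) auto
  from indep_vars_nn_integral_mpol[OF this, of "\<lambda>z. ennreal (z\<^sup>2)" a]
  have L2: "(\<integral>\<^sup>+\<omega>. ennreal ((mpol {1..N} a (\<lambda>i. X i \<omega>))\<^sup>2) \<partial>M) = (\<integral>\<^sup>+x. ennreal ((mpol {1..N} a x)\<^sup>2) \<partial>PiM {1..N} \<mu>)"
    unfolding \<mu>_def by simp
  have hs: "hsum p f N y = mpol {1..N} a y" for y unfolding a_def using f by (rule hsum_mpol)
  have "(\<integral>\<^sup>+\<omega>. ennreal ((hsum p f N (\<lambda>i. X i \<omega>))\<^sup>2) \<partial>M) = (\<integral>\<^sup>+x. ennreal ((mpol {1..N} a x)\<^sup>2) \<partial>PiM {1..N} \<mu>)"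
    unfolding hs by (rule L2)
  also have "\<dots> = ennreal (\<Sum>S\<in>Pow {1..N}. (a S)\<^sup>2)"
  proof (rule mpol_orthonormal)
    show "prob_space (\<mu> i)" for i
      using rv by (auto simp: \<mu>_def intro: prob_space_distr prob_space_return)
    show "sets (\<mu> i) = sets borel" for i by (simp add: \<mu>_def)
    show "(\<integral>\<^sup>+y. ennreal ((c + b * y)\<^sup>2) \<partial>\<mu> i) = ennreal (c\<^sup>2 + b\<^sup>2)" if "i \<in> {1..N}" for i c b
      using nn_integral_affine_sq[of "X i" 0 1 c b] mean[of i] var[of i] rv[of i] that
      by (simp add: \<mu>_def nn_integral_distr)
  qed simp
  also have "(\<Sum>S\<in>Pow {1..N}. (a S)\<^sup>2) \<le> (\<Sum>S\<in>Pow {1..N}. real p ^ p *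
      (if card S = p then \<Sum>l\<in>{l. distinct l \<and> set l = S}. (f l)\<^sup>2 else 0))"
    by (intro sum_mono) (auto simp: a_def intro!: setcoeff_sq_le finite_subset[OF _ finite_atLeastAtMost])
  also have "\<dots> = real p ^ p * (\<Sum>l\<in>{l. length l = p \<and> set l \<subseteq> {1..N}}. (f l)\<^sup>2)"
    unfolding sum_distrib_left[symmetric] using f by (subst sum_distinct_lists) auto
  finally show ?thesis by (simp add: ennreal_leI)
qed

text \<open>The choice in \<open>Qp\<close> has a witness. Second moments of increments of the
  partial sums are dominated by increments of \<open>\<sigma>\<close>, a multiple of the truncated
  squared norm of \<open>f\<close>, which converges by square-summability.\<close>

lemma (in prob_space) is_Qp_Qp:
  assumes ind: "indep_vars (\<lambda>_. borel) X {1..}"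
    and mean: "\<And>i. i \<ge> 1 \<Longrightarrow> integrable M (X i)" "\<And>i. i \<ge> 1 \<Longrightarrow> expectation (X i) = 0"
    and var: "\<And>i. i \<ge> 1 \<Longrightarrow> integrable M (\<lambda>\<omega>. (X i \<omega>)\<^sup>2)" "\<And>i. i \<ge> 1 \<Longrightarrow> expectation (\<lambda>\<omega>. (X i \<omega>)\<^sup>2) = 1"
    and f: "ell2_0_sym p f"
  shows "is_Qp M X p f (Qp M X p f)"
proof -
  let ?L = "\<lambda>n. {l. length l = p \<and> set l \<subseteq> {1..n}}"
  define \<sigma> where "\<sigma> n = real p ^ p * (\<Sum>l\<in>?L n. (f l)\<^sup>2)" for n
  have sub: "?L n \<subseteq> Npow p" for n by (auto simp: Npow_def)
  have zero: "f l = 0" if "length l = p" "set l \<subseteq> {1..n}" "\<not> distinct l" for l n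
  proof -
    have "l \<in> Npow p" using sub[of n] that by blast
    then show ?thesis using f that(3) unfolding ell2_0_sym_def by blast
  qed
  have summable: "(\<lambda>l. (f l)\<^sup>2) summable_on Npow p" using f unfolding ell2_0_sym_def by blast
  have "incseq \<sigma>"
    unfolding \<sigma>_def by (intro monoI mult_left_mono sum_mono2 finite_lists_upto) auto
  moreover have "\<sigma> n \<le> real p ^ p * (\<Sum>\<^sub>\<infinity>l\<in>Npow p. (f l)\<^sup>2)" for n
    unfolding \<sigma>_def using sub summable
    by (intro mult_left_mono finite_sum_le_infsum finite_lists_upto) auto
  ultimately obtain L where L: "\<sigma> \<longlonglongrightarrow> L" "\<forall>n. \<sigma> n \<le> L"
    using incseq_convergent[of \<sigma>] by blast
  have rv: "\<And>i. i \<ge> 1 \<Longrightarrow> X i \<in> borel_measurable M" using mean(1) by auto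
  have meas: "(\<lambda>\<omega>. hsum p f n (\<lambda>i. X i \<omega>)) \<in> borel_measurable M" for n
  proof -
    have "Qp_partial p f X n = (\<lambda>\<omega>. hsum p f n (\<lambda>i. X i \<omega>))" by (rule ext) (simp only: Qp_partial_hsum)
    moreover have "Qp_partial p f X n \<in> borel_measurable M" by (rule measurable_Qp_partial) (rule rv)
    ultimately show ?thesis by simp
  qed
  have incr: "(\<integral>\<^sup>+\<omega>. ennreal ((hsum p f n (\<lambda>i. X i \<omega>) - hsum p f m (\<lambda>i. X i \<omega>))\<^sup>2) \<partial>M) \<le> ennreal (\<sigma> n - \<sigma> m)"
    if "m \<le> n" for m n
  proof -
    have "(\<integral>\<^sup>+\<omega>. ennreal ((hsum p f n (\<lambda>i. X i \<omega>) - hsum p f m (\<lambda>i. X i \<omega>))\<^sup>2) \<partial>M)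
      \<le> ennreal (real p ^ p * (\<Sum>l\<in>?L n. (if set l \<subseteq> {1..m} then 0 else f l)\<^sup>2))"
      unfolding hsum_restrict[OF that]
      by (rule hsum_L2_le[OF ind]) (use mean var zero[of _ n] in auto)
    also have "(\<Sum>l\<in>?L n. (if set l \<subseteq> {1..m} then 0 else f l)\<^sup>2)
        = (\<Sum>l\<in>?L n. (f l)\<^sup>2) - (\<Sum>l\<in>?L m. (f l)\<^sup>2)"
    proof -
      have "(\<Sum>l\<in>?L m. (f l)\<^sup>2) = (\<Sum>l\<in>?L n. if set l \<subseteq> {1..m} then (f l)\<^sup>2 else 0)"
        using that by (intro sum.mono_neutral_cong_left finite_lists_upto) auto
      moreover have "(if set l \<subseteq> {1..m} then 0 else f l)\<^sup>2
          = (f l)\<^sup>2 - (if set l \<subseteq> {1..m} then (f l)\<^sup>2 else 0)" for l by simp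
      ultimately show ?thesis by (simp only: sum_subtractf)
    qed
    finally show ?thesis by (simp only: \<sigma>_def right_diff_distrib)
  qed
  have "\<exists>G\<in>borel_measurable M. (\<lambda>n. \<integral>\<^sup>+\<omega>. ennreal ((G \<omega> - hsum p f n (\<lambda>i. X i \<omega>))\<^sup>2) \<partial>M) \<longlonglongrightarrow> 0"
    by (rule L2_Cauchy_imp_convergent[OF meas incr L(1)]) (use L(2) in auto)
  then obtain G where "G \<in> borel_measurable M"
    "(\<lambda>n. \<integral>\<^sup>+\<omega>. ennreal ((G \<omega> - hsum p f n (\<lambda>i. X i \<omega>))\<^sup>2) \<partial>M) \<longlonglongrightarrow> 0" by blast
  then have "is_Qp M X p f G" by (simp only: is_Qp_def Qp_partial_hsum simp_thms)
  then have "\<exists>G. is_Qp M X p f G" by blast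
  then show ?thesis unfolding Qp_def by (rule someI_ex)
qed

section \<open>Convergence of the chaotic components\<close>

text \<open>Lets the moment exponent be lowered: a bound of order \<open>2 + \<delta>\<close> yields
  one of any smaller order \<open>2 * r\<close>, up to the additive 1 that covers small
  \<open>x\<close>.\<close>

lemma sq_powr_le_abs_powr:
  fixes x r \<delta> :: real
  assumes "0 \<le> r" "2 * r \<le> 2 + \<delta>"
  shows "(x\<^sup>2) powr r \<le> 1 + \<bar>x\<bar> powr (2 + \<delta>)"
proof (cases "x = 0")
  case False
  have "(x\<^sup>2) powr r = (\<bar>x\<bar> powr 2) powr r" using False by simp
  then have eq: "(x\<^sup>2) powr r = \<bar>x\<bar> powr (2 * r)" by (simp only: powr_powr)
  show ?thesis
  proof (cases "\<bar>x\<bar> \<le> 1")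
    case True
    then have "\<bar>x\<bar> powr (2 * r) \<le> 1" using assms by (intro powr_le1) auto
    then show ?thesis unfolding eq by (simp add: add_increasing2)
  next
    case False
    then have "\<bar>x\<bar> powr (2 * r) \<le> \<bar>x\<bar> powr (2 + \<delta>)" using assms by (intro powr_mono) auto
    then show ?thesis unfolding eq by simp
  qed
qed simp

theorem theorem1p3:
  fixes M :: "'a measure" and X :: "nat \<Rightarrow> 'a \<Rightarrow> real" and q :: nat
    and Fs :: "nat \<Rightarrow> 'a \<Rightarrow> real" and F :: "'a \<Rightarrow> real"
    and fs :: "nat \<Rightarrow> nat \<Rightarrow> nat list \<Rightarrow> real" and f :: "nat \<Rightarrow> nat list \<Rightarrow> real"
  assumes "prob_space M"
    and "q \<ge> 2"
    and "\<And>i. i \<ge> 1 \<Longrightarrow> X i \<in> borel_measurable M"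
    and "prob_space.indep_vars M (\<lambda>_. borel) X {1..}"
    and "\<And>i. i \<ge> 1 \<Longrightarrow> integrable M (X i) \<and> prob_space.expectation M (X i) = 0"
    and "\<And>i. i \<ge> 1 \<Longrightarrow> integrable M (\<lambda>\<omega>. (X i \<omega>)\<^sup>2) \<and> prob_space.expectation M (\<lambda>\<omega>. (X i \<omega>)\<^sup>2) = 1"
    and "\<exists>\<delta>>0. \<exists>C::real. \<forall>j\<ge>1. (\<integral>\<^sup>+\<omega>. ennreal (\<bar>X j \<omega>\<bar> powr (2 + \<delta>)) \<partial>M) \<le> ennreal C"
    and "\<And>n. Fs n \<in> borel_measurable M"
    and "\<And>n p. p \<in> {1..q} \<Longrightarrow> ell2_0_sym p (fs p n)"
    and "\<And>n. AE \<omega> in M. Fs n \<omega> = prob_space.expectation M (Fs n)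
                 + (\<Sum>p=1..q. Qp M X p (fs p n) \<omega>)"
    and "F \<in> borel_measurable M"
    and "\<And>p. p \<in> {1..q} \<Longrightarrow> ell2_0_sym p (f p)"
    and "AE \<omega> in M. F \<omega> = prob_space.expectation M F + (\<Sum>p=1..q. Qp M X p (f p) \<omega>)"
    and "AE \<omega> in M. (\<lambda>n. Fs n \<omega>) \<longlonglongrightarrow> F \<omega>"
  shows "(\<lambda>n. prob_space.expectation M (Fs n)) \<longlonglongrightarrow> prob_space.expectation M F
         \<and> (\<forall>p\<in>{1..q}.
           AE \<omega> in M. (\<lambda>n. Qp M X p (fs p n) \<omega>) \<longlonglongrightarrow> Qp M X p (f p) \<omega>)"
proof -
  interpret prob_space M by fact
  note ind = assms(4)
  have mean: "\<And>i. i \<ge> 1 \<Longrightarrow> integrable M (X i)" "\<And>i. i \<ge> 1 \<Longrightarrow> expectation (X i) = 0"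
    using assms(5) by auto
  have var: "\<And>i. i \<ge> 1 \<Longrightarrow> integrable M (\<lambda>\<omega>. (X i \<omega>)\<^sup>2)"
      "\<And>i. i \<ge> 1 \<Longrightarrow> expectation (\<lambda>\<omega>. (X i \<omega>)\<^sup>2) = 1"
    using assms(6) by auto
  obtain r C where r: "1 < r" "r \<le> 2" and "0 \<le> C"
    and mom: "\<And>i. i \<in> {1..} \<Longrightarrow> (\<integral>\<^sup>+\<omega>. ennreal (((X i \<omega>)\<^sup>2) powr r) \<partial>M) \<le> ennreal C"
  proof -
    obtain \<delta> C where \<delta>: "0 < \<delta>"
      and C: "\<And>j. 1 \<le> j \<Longrightarrow> (\<integral>\<^sup>+\<omega>. ennreal (\<bar>X j \<omega>\<bar> powr (2 + \<delta>)) \<partial>M) \<le> ennreal C"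
      using assms(7) by blast
    \<comment> \<open>Capping \<open>\<delta>\<close> at 2 ensures \<open>1 < r \<le> 2\<close>
      while \<open>2 * r \<le> 2 + \<delta>\<close>.\<close>
    define r where "r = 1 + min \<delta> 2 / 2"
    have "(\<integral>\<^sup>+\<omega>. ennreal (((X i \<omega>)\<^sup>2) powr r) \<partial>M) \<le> ennreal (1 + max C 0)" if "i \<in> {1..}" for i
    proof -
      have [measurable]: "X i \<in> borel_measurable M" using assms(3) that by simp
      have "(\<integral>\<^sup>+\<omega>. ennreal (((X i \<omega>)\<^sup>2) powr r) \<partial>M) \<le> (\<integral>\<^sup>+\<omega>. 1 + ennreal (\<bar>X i \<omega>\<bar> powr (2 + \<delta>)) \<partial>M)"
      proof (intro nn_integral_mono)
        fix \<omega>
        have "ennreal (((X i \<omega>)\<^sup>2) powr r) \<le> ennreal (1 + \<bar>X i \<omega>\<bar> powr (2 + \<delta>))"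
          using \<delta> by (intro ennreal_leI sq_powr_le_abs_powr) (auto simp: r_def)
        then show "ennreal (((X i \<omega>)\<^sup>2) powr r) \<le> 1 + ennreal (\<bar>X i \<omega>\<bar> powr (2 + \<delta>))" by simp
      qed
      also have "\<dots> = 1 + (\<integral>\<^sup>+\<omega>. ennreal (\<bar>X i \<omega>\<bar> powr (2 + \<delta>)) \<partial>M)"
        by (simp add: nn_integral_add emeasure_space_1)
      also have "\<dots> \<le> 1 + ennreal (max C 0)"
        using C[of i] that by (intro add_left_mono) (auto intro: order_trans ennreal_leI)
      also have "\<dots> = ennreal (1 + max C 0)" by simp
      finally show ?thesis .
    qed
    then show thesis using \<delta> by (intro that[of r "1 + max C 0"]) (auto simp: r_def)
  qed
  define Q where "Q p n = Qp M X p (fs p n)" for p n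
  define R where "R p = Qp M X p (f p)" for p
  define S where "S p g n \<omega> = hsum p g n (\<lambda>i. X i \<omega>)" for p g n \<omega>
  have S: "Qp_partial p g X n = S p g n" for p g n
    by (intro ext) (simp add: S_def Qp_partial_hsum)
  have [measurable]: "S p g n \<in> borel_measurable M" for p g n
    unfolding S[symmetric] by (rule measurable_Qp_partial) (rule assms(3))
  have Q: "Q p n \<in> borel_measurable M"
      "(\<lambda>N. \<integral>\<^sup>+\<omega>. ennreal ((Q p n \<omega> - S p (fs p n) N \<omega>)\<^sup>2) \<partial>M) \<longlonglongrightarrow> 0" if "p \<in> {1..q}" for p n
  proof -
    have "is_Qp M X p (fs p n) (Qp M X p (fs p n))"
      by (rule is_Qp_Qp[OF ind]) (use mean var assms(9)[OF that] in auto)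
    then show "Q p n \<in> borel_measurable M"
      "(\<lambda>N. \<integral>\<^sup>+\<omega>. ennreal ((Q p n \<omega> - S p (fs p n) N \<omega>)\<^sup>2) \<partial>M) \<longlonglongrightarrow> 0"
      unfolding is_Qp_def Q_def S by blast+
  qed
  have R: "R p \<in> borel_measurable M"
      "(\<lambda>N. \<integral>\<^sup>+\<omega>. ennreal ((R p \<omega> - S p (f p) N \<omega>)\<^sup>2) \<partial>M) \<longlonglongrightarrow> 0" if "p \<in> {1..q}" for p
  proof -
    have "is_Qp M X p (f p) (Qp M X p (f p))"
      by (rule is_Qp_Qp[OF ind]) (use mean var assms(12)[OF that] in auto)
    then show "R p \<in> borel_measurable M"
      "(\<lambda>N. \<integral>\<^sup>+\<omega>. ennreal ((R p \<omega> - S p (f p) N \<omega>)\<^sup>2) \<partial>M) \<longlonglongrightarrow> 0"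
      unfolding is_Qp_def R_def S by blast+
  qed
  \<comment> \<open>One truncation level per \<open>n\<close> serves all orders and both families of
    kernels. The squared errors are summable in mean, so they vanish almost surely along
    \<open>N n\<close>.\<close>
  have "\<exists>N. \<forall>p\<in>{1..q}. (\<integral>\<^sup>+\<omega>. ennreal ((Q p n \<omega> - S p (fs p n) N \<omega>)\<^sup>2) \<partial>M) < ennreal ((1 / 2) ^ n)
      \<and> (\<integral>\<^sup>+\<omega>. ennreal ((R p \<omega> - S p (f p) N \<omega>)\<^sup>2) \<partial>M) < ennreal ((1 / 2) ^ n)" for n
  proof -
    have "\<forall>\<^sub>F N in sequentially. \<forall>p\<in>{1..q}.
        (\<integral>\<^sup>+\<omega>. ennreal ((Q p n \<omega> - S p (fs p n) N \<omega>)\<^sup>2) \<partial>M) < ennreal ((1 / 2) ^ n)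
      \<and> (\<integral>\<^sup>+\<omega>. ennreal ((R p \<omega> - S p (f p) N \<omega>)\<^sup>2) \<partial>M) < ennreal ((1 / 2) ^ n)"
      by (intro eventually_ball_finite ballI eventually_conj order_tendstoD(2)[OF Q(2)] order_tendstoD(2)[OF R(2)]) auto
    then show ?thesis by (rule eventually_happens'[OF sequentially_bot])
  qed
  then have "\<exists>N. \<forall>n. \<forall>p\<in>{1..q}.
        (\<integral>\<^sup>+\<omega>. ennreal ((Q p n \<omega> - S p (fs p n) (N n) \<omega>)\<^sup>2) \<partial>M) < ennreal ((1 / 2) ^ n)
      \<and> (\<integral>\<^sup>+\<omega>. ennreal ((R p \<omega> - S p (f p) (N n) \<omega>)\<^sup>2) \<partial>M) < ennreal ((1 / 2) ^ n)"
    by (intro choice allI)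
  then obtain N where N:
    "\<And>n p. p \<in> {1..q} \<Longrightarrow> (\<integral>\<^sup>+\<omega>. ennreal ((Q p n \<omega> - S p (fs p n) (N n) \<omega>)\<^sup>2) \<partial>M) < ennreal ((1 / 2) ^ n)"
    "\<And>n p. p \<in> {1..q} \<Longrightarrow> (\<integral>\<^sup>+\<omega>. ennreal ((R p \<omega> - S p (f p) (N n) \<omega>)\<^sup>2) \<partial>M) < ennreal ((1 / 2) ^ n)"
    by blast
  have "AE \<omega> in M. \<forall>p\<in>{1..q}. (\<lambda>n. Q p n \<omega> - S p (fs p n) (N n) \<omega>) \<longlonglongrightarrow> 0"
    using N(1) Q(1)
    by (intro AE_finite_allI AE_tendsto_0_of_L2_summable) (auto intro: less_imp_le)
  moreover have "AE \<omega> in M. \<forall>p\<in>{1..q}. (\<lambda>n. R p \<omega> - S p (f p) (N n) \<omega>) \<longlonglongrightarrow> 0"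
    using N(2) R(1)
    by (intro AE_finite_allI AE_tendsto_0_of_L2_summable) (auto intro: less_imp_le)
  ultimately have approx: "AE \<omega> in M. \<forall>p\<in>{1..q}. (\<lambda>n. Q p n \<omega> - S p (fs p n) (N n) \<omega>) \<longlonglongrightarrow> 0
      \<and> (\<lambda>n. R p \<omega> - S p (f p) (N n) \<omega>) \<longlonglongrightarrow> 0"
    by eventually_elim auto
  define e where "e n = expectation (Fs n) - expectation F" for n
  \<comment> \<open>The difference of the means enters as the homogeneous part of degree 0.\<close>
  define g where "g n p l = (if p = 0 then e n else fs p n l - f p l)" for n p and l :: "nat list"
  have g0: "hsum 0 (g n 0) m y = e n" for n m y
  proof -
    have "{l :: nat list. length l = 0 \<and> set l \<subseteq> {1..m}} = {[]}" by auto
    then show ?thesis by (simp add: hsum_def g_def)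
  qed
  have gS: "hsum p (g n p) m (\<lambda>i. X i \<omega>) = S p (fs p n) m \<omega> - S p (f p) m \<omega>" if "p \<in> {1..q}" for p n m \<omega>
    using that by (simp add: S_def hsum_diff g_def[abs_def])
  have split: "(\<Sum>p\<le>q. h p) = h 0 + (\<Sum>p\<in>{1..q}. h p)" for h :: "nat \<Rightarrow> real"
    by (simp add: sum.atLeast_Suc_atMost flip: atMost_atLeast0)
      (metis One_nat_def atMost_atLeast0 sum.atLeast_Suc_atMost le0)
  \<comment> \<open>A monomial over \<open>A\<close> occurs only in the homogeneous part of degree
    \<open>card A\<close>, so these coefficients merge all degrees without overlap.\<close>
  define a where "a n A = (if card A \<le> q then setcoeff (g n (card A)) A else 0)" for n A
  have gzero: "g n p l = 0" if "p \<le> q" "length l = p" "set l \<subseteq> {1..m}" "\<not> distinct l" for n p m l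
  proof -
    \<comment> \<open>Degree 0 is excluded because the empty list is distinct.\<close>
    have p: "p \<in> {1..q}" using that by (cases l) auto
    have "l \<in> Npow p" using that by (auto simp: Npow_def)
    then have "fs p n l = 0" "f p l = 0"
      using assms(9)[OF p, of n] assms(12)[OF p] that(4) unfolding ell2_0_sym_def by blast+
    then show ?thesis using p by (simp add: g_def)
  qed
  have poly: "mpol {1..N n} (a n) y = (\<Sum>p\<le>q. hsum p (g n p) (N n) y)" for n y
  proof -
    have "(\<Sum>p\<le>q. hsum p (g n p) (N n) y)
        = (\<Sum>p\<le>q. mpol {1..N n} (\<lambda>A. if card A = p then setcoeff (g n p) A else 0) y)"
      using gzero by (intro sum.cong refl hsum_mpol) auto
    also have "\<dots> = (\<Sum>A\<in>Pow {1..N n}. \<Sum>p\<le>q. (if card A = p then setcoeff (g n p) A else 0) * (\<Prod>i\<in>A. y i))"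
      unfolding mpol_def by (rule sum.swap)
    also have "\<dots> = mpol {1..N n} (a n) y"
      unfolding mpol_def by (intro sum.cong refl) (simp add: a_def sum_distrib_right[symmetric])
    finally show ?thesis by simp
  qed
  \<comment> \<open>At \<open>X\<close> the polynomial equals \<open>Fs n - F\<close> corrected by
    the truncation errors of both expansions; all of these tend to 0.\<close>
  have "AE \<omega> in M. (\<lambda>n. mpol {1..N n} (a n) (\<lambda>i. X i \<omega>)) \<longlonglongrightarrow> 0"
  proof -
    have "AE \<omega> in M. \<forall>n. Fs n \<omega> = expectation (Fs n) + (\<Sum>p=1..q. Q p n \<omega>)"
      using assms(10) unfolding Q_def by (subst AE_all_countable) auto
    moreover have "AE \<omega> in M. F \<omega> = expectation F + (\<Sum>p=1..q. R p \<omega>)"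
      using assms(13) unfolding R_def .
    ultimately show ?thesis
      using approx assms(14)
    proof eventually_elim
      case (elim \<omega>)
      have eq: "mpol {1..N n} (a n) (\<lambda>i. X i \<omega>) = (Fs n \<omega> - F \<omega>)
         + (\<Sum>p=1..q. (R p \<omega> - S p (f p) (N n) \<omega>) - (Q p n \<omega> - S p (fs p n) (N n) \<omega>))" for n
        unfolding poly split g0 elim(2) elim(1)[rule_format, of n] e_def
        by (simp add: gS sum_subtractf)
      have "(\<lambda>n. (Fs n \<omega> - F \<omega>) + (\<Sum>p=1..q. (R p \<omega> - S p (f p) (N n) \<omega>) - (Q p n \<omega> - S p (fs p n) (N n) \<omega>)))
        \<longlonglongrightarrow> (F \<omega> - F \<omega>) + (\<Sum>p=1..q. 0 - 0)"
        using elim(3,4) by (intro tendsto_add tendsto_diff tendsto_sum tendsto_const) auto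
      then show ?case unfolding eq by simp
    qed
  qed
  then have "AE \<omega> in M. (\<lambda>n. mpol {1..N n} (a n) (\<lambda>i. (1 / 2) ^ k * X i \<omega>)) \<longlonglongrightarrow> 0" if "1 \<le> k" for k :: nat
  proof (intro mpol_scale_tendsto_0[OF ind _ _ _ _ _ mom r \<open>0 \<le> C\<close>, where q=q])
    show "(1 / 2 :: real) ^ k < 1" using that by (simp add: power_less_one_iff)
  qed (use mean var in \<open>auto simp: a_def\<close>)
  then have "AE \<omega> in M. \<forall>k\<in>{1..}. (\<lambda>n. mpol {1..N n} (a n) (\<lambda>i. (1 / 2) ^ k * X i \<omega>)) \<longlonglongrightarrow> 0"
    by (subst AE_ball_countable) auto
  \<comment> \<open>Scaling the argument by \<open>(1 / 2) ^ k\<close> multiplies the part of degree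
    \<open>p\<close> by the \<open>p\<close>-th power of that factor, so for fixed
    \<open>\<omega>\<close> the parts are polynomial coefficients.\<close>
  then have hom: "AE \<omega> in M. \<forall>p\<le>q. (\<lambda>n. hsum p (g n p) (N n) (\<lambda>i. X i \<omega>)) \<longlonglongrightarrow> 0"
  proof eventually_elim
    case (elim \<omega>)
    then have *: "(\<lambda>n. \<Sum>p\<le>q. ((1 / 2) ^ k) ^ p * hsum p (g n p) (N n) (\<lambda>i. X i \<omega>)) \<longlonglongrightarrow> 0" if "1 \<le> k" for k
      using that unfolding poly hsum_scale by simp
    show ?case
    proof (intro allI impI)
      fix p assume "p \<le> q"
      then show "(\<lambda>n. hsum p (g n p) (N n) (\<lambda>i. X i \<omega>)) \<longlonglongrightarrow> 0"
        by (rule polynomial_coeffs_tendsto_0[rotated, where c="\<lambda>p n. hsum p (g n p) (N n) (\<lambda>i. X i \<omega>)"])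
          (rule *)
    qed
  qed
  then have "AE \<omega> in M. e \<longlonglongrightarrow> 0"
    by eventually_elim (auto simp: g0 dest: spec[of _ 0])
  \<comment> \<open>\<open>e\<close> is deterministic, and an almost sure statement without
    randomness holds outright on a probability space.\<close>
  then have "e \<longlonglongrightarrow> 0" by simp
  then have "(\<lambda>n. e n + expectation F) \<longlonglongrightarrow> 0 + expectation F" by (intro tendsto_intros)
  then have means: "(\<lambda>n. expectation (Fs n)) \<longlonglongrightarrow> expectation F" by (simp add: e_def)
  \<comment> \<open>The truncations are undone: the difference of the partial sums tends to 0 and so
    do both truncation errors.\<close>
  have "AE \<omega> in M. (\<lambda>n. Q p n \<omega>) \<longlonglongrightarrow> R p \<omega>" if p: "p \<in> {1..q}" for p
    using hom approx
  proof eventually_elim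
    case (elim \<omega>)
    have "(\<lambda>n. S p (fs p n) (N n) \<omega> - S p (f p) (N n) \<omega>) \<longlonglongrightarrow> 0"
      using elim(1) p gS[OF p] by auto
    then have "(\<lambda>n. (Q p n \<omega> - S p (fs p n) (N n) \<omega>) + (S p (fs p n) (N n) \<omega> - S p (f p) (N n) \<omega>)
        - (R p \<omega> - S p (f p) (N n) \<omega>) + R p \<omega>) \<longlonglongrightarrow> 0 + 0 - 0 + R p \<omega>"
      using elim(2) p by (intro tendsto_add tendsto_diff tendsto_const) auto
    then show ?case by simp
  qed
  then show ?thesis using means unfolding Q_def R_def by blast
qed

end
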